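(* Fix $k\in\mathbb Z_{\ge0}$ and let $(r,t,s)$ be a vertex of the Farey tree $\mathrm{F}\mathbb T$ with $t\in(0,1)$, $r\ne\frac01$ and $s\ne\frac11$. Let $F^-(k,t)$ denote the Hirzebruch–Jung expansion of the value of $F^+(k,t)$, and $G^-(k,r)$, $G^-(k,s)$ the Hirzebruch–Jung expansions of the values of $G^+(k,r)$, $G^+(k,s)$. Then \[F^-(k,t)=[[\,G^-(k,r),\,3k+4,\,G^-(k,s)\,]],\] i.e. the Hirzebruch–Jung expansion of $F^+(k,t)$ is the concatenation of the entries of $G^-(k,r)$, the single entry $3k+4$, and the entries of $G^-(k,s)$.
   Context: Farey tree $\mathrm{F}\mathbb T$: root $\left(\frac01,\frac11,\frac10\right)$; vertex $\left(\frac ab,\frac cd,\frac ef\right)$ has left child $\left(\frac ab,\frac{a+c}{b+d},\frac cd\right)$ and right child $\left(\frac cd,\frac{c+e}{d+f},\frac ef\right)$. Construction for an irreducible fraction $t=a/b$ ($a,b\ge1$): let $L_t$ be the segment from $(0,0)$ to $(b,a)$, oriented left to right. The pre-snake graph is the union of the closed unit lattice squares whose interiors meet $L_t$, each split by its upper-left-to-lower-right diagonal into two right triangles; edges are square sides and these diagonals. Signs: each triangle gets one sign, $-$ if it is the first triangle met by $L_t$ or if its part lying above the line through $L_t$ is a quadrilateral, else $+$; each edge meeting the interior of $L_t$ gets $k$ copies of one sign, $-$ if its midpoint lies on or above the line through $L_t$, $+$ if strictly below. Listing the signs in the order $L_t$ passes through triangles and edges and letting $a_1,\dots,a_\ell$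 be the lengths of successive maximal blocks of equal signs gives $F^+(k,t)=[a_1,\dots,a_\ell]=a_1+\cfrac1{a_2+\cfrac1{\ddots+\cfrac1{a_\ell}}}$. $G^+(k,t)$ is obtained the same way except that the $k$ signs on the central edge (the edge containing the midpoint $(b/2,a/2)$ of $L_t$) are $+$ instead of $-$. Every rational $x>1$ has a unique Hirzebruch–Jung expansion $[[b_1,\dots,b_s]]:=b_1-\cfrac1{b_2-\cfrac1{\ddots-\cfrac1{b_s}}}$ with integers $b_i\ge2$. *)

theory Defs
  imports "HOL-Analysis.Analysis"
begin

section \<open>The Farey tree\<close>

text \<open>The pair \<open>(a, b)\<close> stands for the fraction a/b as written; this accommodates 1/0.\<close>

type_synonym fraction = "nat \<times> nat"

definition frac_val :: "fraction \<Rightarrow> rat" where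
  "frac_val t = of_nat (fst t) / of_nat (snd t)"

inductive farey_vertex :: "fraction \<Rightarrow> fraction \<Rightarrow> fraction \<Rightarrow> bool" where
  root: "farey_vertex (0, 1) (1, 1) (1, 0)"
| left: "farey_vertex (a, b) (c, d) (e, f) \<Longrightarrow> farey_vertex (a, b) (a + c, b + d) (c, d)"
| right: "farey_vertex (a, b) (c, d) (e, f) \<Longrightarrow> farey_vertex (c, d) (c + e, d + f) (e, f)"


section \<open>The pre-snake graph\<close>

type_synonym point = "real \<times> real"

definition seg_end :: "fraction \<Rightarrow> point" where
  "seg_end t = (real (snd t), real (fst t))"

definition seg :: "fraction \<Rightarrow> point set" where
  "seg t = closed_segment (0, 0) (seg_end t)"

definition seg_interior :: "fraction \<Rightarrow> point set" where
  "seg_interior t = open_segment (0, 0) (seg_end t)"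

text \<open>The closed half plane on or above the line through the segment.\<close>

definition upper_half :: "fraction \<Rightarrow> point set" where
  "upper_half t = {(x, y). real (fst t) * x \<le> real (snd t) * y}"

definition lattice_pt :: "int \<Rightarrow> int \<Rightarrow> point" where
  "lattice_pt i j = (of_int i, of_int j)"

definition unit_square :: "int \<Rightarrow> int \<Rightarrow> point set" where
  "unit_square i j = cbox (lattice_pt i j) (lattice_pt (i + 1) (j + 1))"

definition squares :: "fraction \<Rightarrow> (int \<times> int) set" where
  "squares t = {(i, j). interior (unit_square i j) \<inter> seg t \<noteq> {}}"

text \<open>
  Triangles are named by the lower left corner of their square. A horizontal (vertical) edge is
  named by its left (lower) end point, so that an edge shared by two squares has only one name.
\<close>

datatype half = LowerLeft | UpperRight

datatype dir = Horizontal | Vertical | Diagonal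

datatype cell = is_Tri: Tri half int int | Edge dir int int

fun edge_ends :: "dir \<Rightarrow> int \<Rightarrow> int \<Rightarrow> point \<times> point" where
  "edge_ends Horizontal i j = (lattice_pt i j, lattice_pt (i + 1) j)"
| "edge_ends Vertical i j = (lattice_pt i j, lattice_pt i (j + 1))"
| "edge_ends Diagonal i j = (lattice_pt i (j + 1), lattice_pt (i + 1) j)"

fun region :: "cell \<Rightarrow> point set" where
  "region (Tri LowerLeft i j) =
     convex hull {lattice_pt i j, lattice_pt (i + 1) j, lattice_pt i (j + 1)}"
| "region (Tri UpperRight i j) =
     convex hull {lattice_pt (i + 1) (j + 1), lattice_pt (i + 1) j, lattice_pt i (j + 1)}"
| "region (Edge d i j) = closed_segment (fst (edge_ends d i j)) (snd (edge_ends d i j))"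

definition triangles :: "fraction \<Rightarrow> cell set" where
  "triangles t = (\<Union>(i, j) \<in> squares t. {Tri LowerLeft i j, Tri UpperRight i j})"

definition edges :: "fraction \<Rightarrow> cell set" where
  "edges t = (\<Union>(i, j) \<in> squares t.
     {Edge Horizontal i j, Edge Horizontal i (j + 1),
      Edge Vertical i j, Edge Vertical (i + 1) j, Edge Diagonal i j})"

definition crossed_edges :: "fraction \<Rightarrow> cell set" where
  "crossed_edges t = {e \<in> edges t. region e \<inter> seg_interior t \<noteq> {}}"

text \<open>
  The segment meets each triangle of the pre-snake graph in a nondegenerate segment and each
  crossed edge in one point. The x-coordinates of the midpoints of these intersections increase
  strictly in the order in which the segment passes through triangles and edges.
\<close>

definition position :: "fraction \<Rightarrow> cell \<Rightarrow> real" where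
  "position t c = (Inf (fst ` (region c \<inter> seg t)) + Sup (fst ` (region c \<inter> seg t))) / 2"

definition traversal :: "fraction \<Rightarrow> cell list" where
  "traversal t = sorted_key_list_of_set (position t) (triangles t \<union> crossed_edges t)"


section \<open>Signs and continued fractions\<close>

datatype sign = SMinus | SPlus

definition quadrilateral :: "point set \<Rightarrow> bool" where
  "quadrilateral S \<longleftrightarrow> polytope S \<and> card {v. v extreme_point_of S} = 4"

definition first_triangle :: "fraction \<Rightarrow> cell" where
  "first_triangle t = hd (filter is_Tri (traversal t))"

definition tri_sign :: "fraction \<Rightarrow> cell \<Rightarrow> sign" where
  "tri_sign t c =
     (if c = first_triangle t \<or> quadrilateral (region c \<inter> upper_half t) then SMinus else SPlus)"

definition edge_sign :: "fraction \<Rightarrow> dir \<Rightarrow> int \<Rightarrow> int \<Rightarrow> sign" where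
  "edge_sign t d i j =
     (if midpoint (fst (edge_ends d i j)) (snd (edge_ends d i j)) \<in> upper_half t
      then SMinus else SPlus)"

definition central_edge :: "fraction \<Rightarrow> cell \<Rightarrow> bool" where
  "central_edge t e \<longleftrightarrow> midpoint (0, 0) (seg_end t) \<in> region e"

fun F_cell_signs :: "nat \<Rightarrow> fraction \<Rightarrow> cell \<Rightarrow> sign list" where
  "F_cell_signs k t (Tri h i j) = [tri_sign t (Tri h i j)]"
| "F_cell_signs k t (Edge d i j) = replicate k (edge_sign t d i j)"

fun G_cell_signs :: "nat \<Rightarrow> fraction \<Rightarrow> cell \<Rightarrow> sign list" where
  "G_cell_signs k t (Tri h i j) = [tri_sign t (Tri h i j)]"
| "G_cell_signs k t (Edge d i j) =
     replicate k (if central_edge t (Edge d i j) then SPlus else edge_sign t d i j)"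

definition F_signs :: "nat \<Rightarrow> fraction \<Rightarrow> sign list" where
  "F_signs k t = concat (map (F_cell_signs k t) (traversal t))"

definition G_signs :: "nat \<Rightarrow> fraction \<Rightarrow> sign list" where
  "G_signs k t = concat (map (G_cell_signs k t) (traversal t))"

text \<open>Lengths of the successive maximal blocks of equal entries.\<close>

function block_lengths :: "'a list \<Rightarrow> nat list" where
  "block_lengths [] = []"
| "block_lengths (x # xs) =
     Suc (length (takeWhile ((=) x) xs)) # block_lengths (dropWhile ((=) x) xs)"
  by pat_completeness auto

termination
  by (relation "Wellfounded.measure length") (auto simp: le_imp_less_Suc length_dropWhile_le)

text \<open>The values at the empty list are immaterial.\<close>

fun cf_val :: "nat list \<Rightarrow> rat" where
  "cf_val [] = 0"
| "cf_val [a] = of_nat a"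
| "cf_val (a # b # bs) = of_nat a + 1 / cf_val (b # bs)"

fun hj_val :: "int list \<Rightarrow> rat" where
  "hj_val [] = 0"
| "hj_val [a] = of_int a"
| "hj_val (a # b # bs) = of_int a - 1 / hj_val (b # bs)"

definition F_plus :: "nat \<Rightarrow> fraction \<Rightarrow> rat" where
  "F_plus k t = cf_val (block_lengths (F_signs k t))"

definition G_plus :: "nat \<Rightarrow> fraction \<Rightarrow> rat" where
  "G_plus k t = cf_val (block_lengths (G_signs k t))"

definition is_hj_expansion :: "rat \<Rightarrow> int list \<Rightarrow> bool" where
  "is_hj_expansion x bs \<longleftrightarrow> bs \<noteq> [] \<and> (\<forall>b \<in> set bs. 2 \<le> b) \<and> hj_val bs = x"

definition hj_expansion :: "rat \<Rightarrow> int list" where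
  "hj_expansion x = (THE bs. is_hj_expansion x bs)"

definition F_minus :: "nat \<Rightarrow> fraction \<Rightarrow> int list" where
  "F_minus k t = hj_expansion (F_plus k t)"

definition G_minus :: "nat \<Rightarrow> fraction \<Rightarrow> int list" where
  "G_minus k t = hj_expansion (G_plus k t)"


subsection \<open>Existence and uniqueness of the Hirzebruch--Jung expansion\<close>

lemma hj_val_gt_1:
  assumes "bs \<noteq> []" "\<forall>b \<in> set bs. 2 \<le> b"
  shows "hj_val bs > 1"
  using assms
proof (induction bs rule: hj_val.induct)
  case (3 a b bs)
  then have "hj_val (b # bs) > 1" "a \<ge> 2" by auto
  then have "1 / hj_val (b # bs) < 1" "of_int a \<ge> (2 :: rat)" by auto
  then show ?case by simp
qed auto

lemma ceiling_hj_val: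
  assumes "bs \<noteq> []" "\<forall>b \<in> set bs. 2 \<le> b"
  shows "\<lceil>hj_val bs\<rceil> = hd bs"
proof (cases bs rule: hj_val.cases)
  case (3 a b cs)
  have "hj_val (b # cs) > 1" using assms 3 by (intro hj_val_gt_1) auto
  then have "0 < 1 / hj_val (b # cs)" "1 / hj_val (b # cs) < 1" by auto
  then show ?thesis using 3 by (simp add: ceiling_eq_iff)
qed (use assms in auto)

lemma is_hj_expansion_unique:
  "is_hj_expansion x bs \<Longrightarrow> is_hj_expansion x cs \<Longrightarrow> bs = cs"
proof (induction bs arbitrary: x cs)
  case Nil
  then show ?case by (simp add: is_hj_expansion_def)
next
  case (Cons b bs)
  then obtain c cs' where cs: "cs = c # cs'"
    by (cases cs) (auto simp: is_hj_expansion_def)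
  have B: "\<forall>b \<in> set (b # bs). 2 \<le> b" "hj_val (b # bs) = x"
    and C: "\<forall>b \<in> set (c # cs'). 2 \<le> b" "hj_val (c # cs') = x"
    using Cons.prems cs by (auto simp: is_hj_expansion_def)
  have bc: "b = c"
    using ceiling_hj_val[OF _ B(1)] ceiling_hj_val[OF _ C(1)] B(2) C(2) by simp
  have pos: "hj_val ds > 1" if "ds = bs \<or> ds = cs'" "ds \<noteq> []" for ds
    using that B C by (intro hj_val_gt_1) auto
  have step: "hj_val (b # ds) = of_int b - (if ds = [] then 0 else 1 / hj_val ds)" for ds
    by (cases ds) auto
  have eq: "(if bs = [] then 0 else 1 / hj_val bs) = (if cs' = [] then 0 else 1 / hj_val cs')"
    using B(2) C(2) step[of bs] step[of cs'] bc by simp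
  show ?case
  proof (cases "bs = []")
    case True
    then have "cs' = []" using eq pos[of cs'] by (auto split: if_splits)
    then show ?thesis using True bc cs by simp
  next
    case False
    then have ne: "cs' \<noteq> []" using eq pos[of bs] by (auto split: if_splits)
    then have "hj_val bs = hj_val cs'" using False eq by simp
    then have "bs = cs'"
      using Cons.IH[of "hj_val bs" cs'] False ne B(1) C(1) by (auto simp: is_hj_expansion_def)
    then show ?thesis using bc cs by simp
  qed
qed

lemma is_hj_expansion_exists_aux:
  fixes p q :: nat
  assumes "0 < q" "q < p"
  shows "\<exists>bs. is_hj_expansion (of_nat p / of_nat q) bs"
  using assms
proof (induction q arbitrary: p rule: less_induct)
  case (less q)
  show ?case
  proof (cases "q dvd p")
    case True
    then obtain c where c: "p = q * c" by (auto simp: dvd_def)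
    have "c \<noteq> 0" "c \<noteq> 1" using less.prems c by auto
    then have "is_hj_expansion (of_nat p / of_nat q) [int c]"
      using less.prems c by (simp add: is_hj_expansion_def)
    then show ?thesis by blast
  next
    case False
    define d where "d = p div q"
    define m where "m = p mod q"
    define r where "r = q - m"
    have m: "0 < m" "m < q" using False less.prems by (auto simp: m_def dvd_eq_mod_eq_0)
    then have r: "0 < r" "r < q" by (auto simp: r_def)
    have "d * q + m = p" by (simp add: d_def m_def)
    then have p: "p + r = (d + 1) * q" using m by (simp add: r_def)
    have "d \<ge> 1" using less.prems by (simp add: d_def Suc_le_eq div_greater_zero_iff)
    obtain bs where bs: "is_hj_expansion (of_nat q / of_nat r) bs"
      using less.IH[OF r(2) r(1) r(2)] by blast
    have "(of_nat p :: rat) = (of_nat d + 1) * of_nat q - of_nat r"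
      using arg_cong[OF p, of "of_nat :: nat \<Rightarrow> rat"] by (simp add: algebra_simps)
    then have "of_nat p / of_nat q = of_nat d + 1 - 1 / (of_nat q / of_nat r :: rat)"
      using r by (simp add: field_simps)
    then have "is_hj_expansion (of_nat p / of_nat q) ((int d + 1) # bs)"
      using bs \<open>d \<ge> 1\<close> by (cases bs) (auto simp: is_hj_expansion_def)
    then show ?thesis by blast
  qed
qed

lemma ex1_hj_expansion:
  assumes "x > 1"
  shows "\<exists>!bs. is_hj_expansion x bs"
proof -
  obtain p q where pq: "quotient_of x = (p, q)" by fastforce
  have x: "x = of_int p / of_int q" using pq by (rule quotient_of_div)
  have q: "q > 0" using pq by (rule quotient_of_denom_pos)
  have "q < p" using assms x q by (simp add: less_divide_eq)
  then have "\<exists>bs. is_hj_expansion (of_nat (nat p) / of_nat (nat q)) bs"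
    using q by (intro is_hj_expansion_exists_aux) auto
  then show ?thesis using x q \<open>q < p\<close> is_hj_expansion_unique by auto
qed

end

theory Submission
  imports Defs
begin

text \<open>
  A sign word that begins with \<open>-\<close> and ends with \<open>+\<close> has one Hirzebruch--Jung entry per \<open>+\<close>, namely
  2 plus the number of \<open>-\<close> directly before it, diminished by 1 for the first entry. So the theorem
  says that the word of \<open>F\<^sup>+(k, t)\<close> is the word of \<open>G\<^sup>+(k, r)\<close>, then \<open>3k + 2\<close> times \<open>-\<close>, then the
  word of \<open>G\<^sup>+(k, s)\<close> with its initial \<open>-\<close> replaced by \<open>+\<close>.

  Let \<open>r = p/q\<close>, \<open>s = p'/q'\<close> and \<open>t = (p + p')/(q + q')\<close> with \<open>q p' - p q' = 1\<close>. The path from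
  \<open>(0, 0)\<close> over \<open>(q, p)\<close> to \<open>(q + q', p + p')\<close> lies below the segment of \<open>t\<close> and bounds together
  with it a triangle without further lattice points. Hence the segment of \<open>t\<close> crosses the cells of
  \<open>r\<close>, passes around \<open>(q, p)\<close> through five further cells, and crosses the translated cells of \<open>s\<close>.
  Lattice points and edge midpoints keep their side of the line, except that those on the segments
  of \<open>r\<close> and \<open>s\<close> end up below it; this is the difference between \<open>F\<close> and \<open>G\<close>.
\<close>

section \<open>Sign words and Hirzebruch--Jung expansions\<close>

text \<open>\<open>m\<close> carries the number of minus signs read since the last plus sign. The
  start value \<open>- 1\<close> accounts for the smaller first entry.\<close>

primrec hj_digits :: "int \<Rightarrow> sign list \<Rightarrow> int list" where
  "hj_digits m [] = []"
| "hj_digits m (x # w) =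
     (case x of SMinus \<Rightarrow> hj_digits (m + 1) w | SPlus \<Rightarrow> (m + 2) # hj_digits 0 w)"

lemma hj_digits_eq_Nil_iff: "hj_digits m w = [] \<longleftrightarrow> SPlus \<notin> set w"
  by (induction w arbitrary: m) (auto split: sign.split)

lemma hj_digits_ge_2: "0 \<le> m \<Longrightarrow> \<forall>b \<in> set (hj_digits m w). 2 \<le> b"
proof (induction w arbitrary: m)
  case (Cons x w)
  then show ?case using Cons.IH[of "m + 1"] Cons.IH[of 0] by (cases x) auto
qed simp

text \<open>The counter is back at 0 after a plus sign, so cutting the word there cuts the list of
  entries too.\<close>

lemma hj_digits_append:
  assumes "w \<noteq> []" "last w = SPlus"
  shows "hj_digits m (w @ v) = hj_digits m w @ hj_digits 0 v"
  using assms by (induction w arbitrary: m) (auto split: sign.split if_splits)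

lemma hj_digits_replicate: "hj_digits m (replicate n SMinus @ w) = hj_digits (m + int n) w"
  by (induction n arbitrary: m) (auto simp: algebra_simps)

text \<open>The initial counter enters only the first entry, and the value is additive in that
  entry.\<close>

lemma hj_digits_add:
  assumes "SPlus \<in> set w"
  shows "hj_val (hj_digits (m + n) w) = of_int n + hj_val (hj_digits m w)"
  using assms
proof (induction w arbitrary: m)
  case (Cons x w)
  show ?case
  proof (cases x)
    case SMinus
    then show ?thesis using Cons.IH[of "m + 1"] Cons.prems by (simp add: algebra_simps)
  next
    case SPlus
    then show ?thesis by (cases "hj_digits 0 w") auto
  qed
qed simp

section \<open>Continued fractions of sign words\<close>

lemma cf_val_Cons: "cf_val (a # bs) = of_nat a + (if bs = [] then 0 else 1 / cf_val bs)"
  by (cases bs) auto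

lemma cf_val_Suc: "cf_val (Suc a # bs) = 1 + cf_val (a # bs)"
  by (simp add: cf_val_Cons)

definition word_val :: "'a list \<Rightarrow> rat" where
  "word_val w = cf_val (block_lengths w)"

lemma word_val_single: "word_val [x] = 1"
  by (simp add: word_val_def)

lemma word_val_same: "word_val (x # x # w) = 1 + word_val (x # w)"
  by (simp add: word_val_def cf_val_Suc)

lemma word_val_diff: "x \<noteq> y \<Longrightarrow> word_val (x # y # w) = 1 + 1 / word_val (y # w)"
  by (simp add: word_val_def)

lemma word_val_pos: "0 < word_val (x # w)"
proof (induction w arbitrary: x)
  case (Cons y w)
  have "1 + word_val (x # w) > 0" using Cons[of x] by linarith
  moreover have "1 + 1 / word_val (y # w) > 0" using Cons[of y] by (simp add: add_pos_pos)
  ultimately show ?case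
    by (cases "x = y") (simp_all add: word_val_same word_val_diff)
qed (simp add: word_val_single)

text \<open>
  Inverting the value of words that begin with \<open>SPlus\<close> makes the effect of prepending a sign
  independent of the next sign.
\<close>

definition signed_val :: "sign list \<Rightarrow> rat" where
  "signed_val w = (if hd w = SMinus then word_val w else 1 / word_val w)"

text \<open>Either the first block grows by one, or a new block of length 1 precedes it; the latter
  adds 1 to the reciprocal, which is the signed value of a word that begins with plus.\<close>

lemma signed_val_SMinus:
  "w \<noteq> [] \<Longrightarrow> signed_val (SMinus # w) = 1 + signed_val w"
  by (cases w; cases "hd w") (auto simp: signed_val_def word_val_same word_val_diff)

text \<open>This is the map \<open>x\<close> to \<open>x / (1 + x)\<close>, the conjugate of adding
  1 under inversion, written as a Hirzebruch--Jung step.\<close>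

lemma signed_val_SPlus:
  assumes "w \<noteq> []"
  shows "signed_val (SPlus # w) = 1 - 1 / (1 + signed_val w)"
proof -
  obtain x v where w: "w = x # v" using assms by (cases w) auto
  have pos: "word_val w > 0" using word_val_pos w by simp
  show ?thesis
  proof (cases x)
    case SMinus
    then have "signed_val (SPlus # w) = 1 / (1 + 1 / word_val w)"
      by (simp add: w signed_val_def word_val_diff)
    moreover have "signed_val w = word_val w" using SMinus w by (simp add: signed_val_def)
    ultimately show ?thesis using pos by (simp add: field_simps)
  next
    case SPlus
    then have "signed_val (SPlus # w) = 1 / (1 + word_val w)"
      by (simp add: w signed_val_def word_val_same)
    moreover have "signed_val w = 1 / word_val w" using SPlus w by (simp add: signed_val_def)
    moreover have "1 / (1 + word_val w) = 1 - 1 / (1 + 1 / word_val w)"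
      using pos by (simp add: divide_simps)
    ultimately show ?thesis by simp
  qed
qed

text \<open>With counter \<open>- 1\<close>, a minus sign raises the first entry by 1, and a plus
  sign puts an entry 1 before a list of value \<open>1 + signed_val w\<close>. These are the two
  rules for signed values.\<close>

lemma hj_val_hj_digits:
  assumes "w \<noteq> []" "last w = SPlus"
  shows "hj_val (hj_digits (- 1) w) = signed_val w"
  using assms
proof (induction w)
  case (Cons x w)
  show ?case
  proof (cases "w = []")
    case True
    then show ?thesis using Cons.prems by (simp add: signed_val_def word_val_single)
  next
    case False
    then have IH: "hj_val (hj_digits (- 1) w) = signed_val w" using Cons by simp
    have plus: "SPlus \<in> set w" using Cons.prems False last_in_set[of w] by simp
    have step: "hj_val (hj_digits 0 w) = 1 + signed_val w"
      using hj_digits_add[OF plus, of "- 1" 1] IH by simp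
    show ?thesis
    proof (cases x)
      case SMinus
      then show ?thesis using step False by (simp add: signed_val_SMinus)
    next
      case SPlus
      obtain d ds where d: "hj_digits 0 w = d # ds"
        using plus hj_digits_eq_Nil_iff[of 0 w] by (cases "hj_digits 0 w") auto
      have "hj_val (hj_digits (- 1) (x # w)) = 1 - 1 / hj_val (hj_digits 0 w)"
        using SPlus d by simp
      then show ?thesis using step False SPlus by (simp add: signed_val_SPlus)
    qed
  qed
qed simp

text \<open>The leading minus sign lifts the counter from \<open>- 1\<close> to 0, so all entries
  are at least 2 and uniqueness of the expansion applies.\<close>

lemma hj_expansion_word_val:
  assumes "w \<noteq> []" "last w = SPlus"
  shows "hj_expansion (cf_val (block_lengths (SMinus # w))) = hj_digits 0 w"
proof -
  have "hj_val (hj_digits 0 w) = word_val (SMinus # w)"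
    using hj_val_hj_digits[of "SMinus # w"] assms by (simp add: signed_val_def)
  moreover have "SPlus \<in> set w" using assms last_in_set[of w] by simp
  ultimately have "is_hj_expansion (word_val (SMinus # w)) (hj_digits 0 w)"
    using hj_digits_ge_2[of 0 w] hj_digits_eq_Nil_iff[of 0 w] by (simp add: is_hj_expansion_def)
  then show ?thesis
    unfolding hj_expansion_def word_val_def[symmetric] 
    using is_hj_expansion_unique by (intro the_equality) blast+
qed

text \<open>\<open>v\<close> ends with plus, so the block of \<open>n\<close> minus signs is counted
  from 0. After the plus sign in the middle the counter is 0 again, just as it is after the leading
  minus sign of \<open>SMinus # w\<close>.\<close>

lemma hj_expansion_glue:
  assumes "v \<noteq> []" "last v = SPlus" "w \<noteq> []" "last w = SPlus"
  shows "hj_expansion (cf_val (block_lengths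
             ((SMinus # v) @ replicate n SMinus @ [SPlus] @ w))) =
         hj_expansion (cf_val (block_lengths (SMinus # v))) @ [int n + 2] @
         hj_expansion (cf_val (block_lengths (SMinus # w)))"
  using assms hj_expansion_word_val[of "v @ replicate n SMinus @ [SPlus] @ w"]
  by (simp add: hj_expansion_word_val hj_digits_append hj_digits_replicate del: block_lengths.simps)


section \<open>Half-plane sections of triangles\<close>

lemma not_in_convex_hull_if_inner_less:
  fixes x :: "'a :: euclidean_space"
  assumes "\<And>y. y \<in> T \<Longrightarrow> z \<bullet> y < z \<bullet> x"
  shows "x \<notin> convex hull T"
proof -
  have "convex hull T \<subseteq> {y. z \<bullet> y < z \<bullet> x}"
    using assms by (intro hull_minimal) (auto simp: convex_halfspace_lt)
  then show ?thesis by auto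
qed

lemma in_convex_hull_3I:
  assumes "0 \<le> u" "0 \<le> v" "0 \<le> w" "u + v + w = (1 :: real)"
    and "p = u *\<^sub>R A + v *\<^sub>R B + w *\<^sub>R C"
  shows "p \<in> convex hull {A, B, C}"
  using assms unfolding convex_hull_3 by blast

lemma in_convex_hull_4I:
  assumes "0 \<le> u" "0 \<le> v" "0 \<le> w" "0 \<le> z" "u + v + w + z = (1 :: real)"
    and "p = u *\<^sub>R A + v *\<^sub>R B + w *\<^sub>R C + z *\<^sub>R D"
  shows "p \<in> convex hull {A, B, C, D}"
proof -
  define c where "c = (\<lambda>i :: nat. [u, v, w, z] ! i)"
  define f where "f = (\<lambda>i :: nat. [A, B, C, D] ! i)"
  have idx: "{..<4 :: nat} = {0, 1, 2, 3}" by auto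
  have "(\<Sum>i<4. c i *\<^sub>R f i) \<in> convex hull {A, B, C, D}"
  proof (rule convex_sum)
    fix i :: nat assume "i \<in> {..<4}"
    then have i: "i \<in> {0, 1, 2, 3}" using idx by simp
    then show "0 \<le> c i" using assms by (auto simp: c_def)
    show "f i \<in> convex hull {A, B, C, D}"
      using i by (intro hull_inc) (auto simp: f_def)
  qed (use assms idx in \<open>auto simp: c_def\<close>)
  then show ?thesis using assms idx by (simp add: c_def f_def add.assoc)
qed

text \<open>Only the corner \<open>C\<close> is strictly above the line. The section is the hull of
  \<open>C\<close> and the points \<open>X\<close>, \<open>Y\<close> where the line meets the sides
  \<open>AC\<close> and \<open>BC\<close>, which has at most three extreme points.\<close>

lemma not_quadrilateral_slice:
  fixes A B C :: point
  assumes A: "w \<bullet> A \<le> 0" and B: "w \<bullet> B \<le> 0" and C: "0 < w \<bullet> C"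
  shows "\<not> quadrilateral (convex hull {A, B, C} \<inter> {x. 0 \<le> w \<bullet> x})"
proof -
  define a b c where "a = w \<bullet> A" and "b = w \<bullet> B" and "c = w \<bullet> C"
  define X Y where "X = (1 / (c - a)) *\<^sub>R (c *\<^sub>R A - a *\<^sub>R C)"
    and "Y = (1 / (c - b)) *\<^sub>R (c *\<^sub>R B - b *\<^sub>R C)"
  have abc: "a \<le> 0" "b \<le> 0" "0 < c" using assms by (auto simp: a_def b_def c_def)
  have neg: "a / (c - a) \<le> 0" "b / (c - b) \<le> 0" using abc by (auto intro: divide_nonpos_pos)
  have cX: "(c - a) *\<^sub>R X = c *\<^sub>R A - a *\<^sub>R C" and cY: "(c - b) *\<^sub>R Y = c *\<^sub>R B - b *\<^sub>R C"
    using abc by (auto simp: X_def Y_def)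
  let ?S = "convex hull {A, B, C} \<inter> {x. 0 \<le> w \<bullet> x}"
  have "?S \<subseteq> convex hull {X, Y, C}"
  proof
    fix p assume p: "p \<in> ?S"
    then obtain u v z where uvz: "0 \<le> u" "0 \<le> v" "0 \<le> z" "u + v + z = 1"
      and p_eq: "p = u *\<^sub>R A + v *\<^sub>R B + z *\<^sub>R C"
      unfolding convex_hull_3 by auto
    \<comment> \<open>\<open>g\<close> is \<open>w \<bullet> p\<close>. Rewriting \<open>A\<close>
      by \<open>X\<close> and \<open>C\<close>, and \<open>B\<close> by \<open>Y\<close> and
      \<open>C\<close>, leaves the weight \<open>g / c\<close> on \<open>C\<close>.\<close>
    define g where "g = u * a + v * b + z * c"
    have g: "0 \<le> g" using p p_eq by (simp add: g_def a_def b_def c_def inner_simps)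
    show "p \<in> convex hull {X, Y, C}"
    proof (rule in_convex_hull_3I)
      show "0 \<le> u * (c - a) / c" "0 \<le> v * (c - b) / c" "0 \<le> g / c"
        using uvz abc g by auto
      have "u * (c - a) + v * (c - b) + g = (u + v + z) * c" by (simp add: g_def algebra_simps)
      then show "u * (c - a) / c + v * (c - b) / c + g / c = 1"
        using abc uvz by (simp flip: add_divide_distrib)
      have "c *\<^sub>R p = u *\<^sub>R (c *\<^sub>R A - a *\<^sub>R C) + v *\<^sub>R (c *\<^sub>R B - b *\<^sub>R C) + g *\<^sub>R C"
        by (simp add: p_eq g_def algebra_simps)
      also have "\<dots> = u *\<^sub>R ((c - a) *\<^sub>R X) + v *\<^sub>R ((c - b) *\<^sub>R Y) + g *\<^sub>R C"
        by (simp add: cX cY)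
      also have "\<dots> = c *\<^sub>R ((u * (c - a) / c) *\<^sub>R X + (v * (c - b) / c) *\<^sub>R Y + (g / c) *\<^sub>R C)"
        using abc by (simp add: scaleR_add_right)
      finally show "p = (u * (c - a) / c) *\<^sub>R X + (v * (c - b) / c) *\<^sub>R Y + (g / c) *\<^sub>R C"
        using abc by (simp only: scaleR_cancel_left) simp
    qed
  qed
  moreover have "convex hull {X, Y, C} \<subseteq> ?S"
  proof (rule hull_minimal)
    have "X \<in> convex hull {A, B, C}"
      by (rule in_convex_hull_3I[of "c / (c - a)" 0 "- a / (c - a)"])
        (use abc neg in \<open>auto simp: X_def algebra_simps simp flip: add_divide_distrib diff_divide_distrib\<close>)
    moreover have "Y \<in> convex hull {A, B, C}"
      by (rule in_convex_hull_3I[of 0 "c / (c - b)" "- b / (c - b)"])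
        (use abc neg in \<open>auto simp: Y_def algebra_simps simp flip: add_divide_distrib diff_divide_distrib\<close>)
    moreover have "w \<bullet> X = 0" "w \<bullet> Y = 0"
      by (auto simp: X_def Y_def inner_simps a_def b_def c_def)
    moreover have "C \<in> convex hull {A, B, C}" by (simp add: hull_inc)
    ultimately show "{X, Y, C} \<subseteq> ?S" using C by auto
    show "convex ?S" by (intro convex_Int convex_convex_hull convex_halfspace_ge)
  qed
  ultimately have S: "?S = convex hull {X, Y, C}" by blast
  have "{v. v extreme_point_of ?S} \<subseteq> {X, Y, C}"
    unfolding S using extreme_point_of_convex_hull by blast
  then have "card {v. v extreme_point_of ?S} \<le> card {X, Y, C}" by (intro card_mono) auto
  also have "\<dots> \<le> 3" by (simp add: card_insert_if)
  finally show ?thesis by (simp add: quadrilateral_def)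
qed

text \<open>The line cuts the sides \<open>AB\<close> and \<open>AC\<close> in inner points
  \<open>X\<close> and \<open>Y\<close>, and the section is the hull of \<open>X\<close>,
  \<open>Y\<close>, \<open>B\<close>, \<open>C\<close>. The functionals \<open>f\<close> and
  \<open>h\<close> are affine coordinates with origin \<open>A\<close> and unit vectors
  \<open>B - A\<close>, \<open>C - A\<close>; they express that the triangle is nondegenerate and
  separate each of the four points from the other three.\<close>

lemma quadrilateral_slice:
  fixes A B C :: point
  assumes A: "w \<bullet> A < 0" and B: "0 < w \<bullet> B" and C: "0 < w \<bullet> C"
    and f: "f \<bullet> (B - A) = 1" "f \<bullet> (C - A) = 0" and h: "h \<bullet> (B - A) = 0" "h \<bullet> (C - A) = 1"
  shows "quadrilateral (convex hull {A, B, C} \<inter> {x. 0 \<le> w \<bullet> x})"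
proof -
  define a b c where "a = w \<bullet> A" and "b = w \<bullet> B" and "c = w \<bullet> C"
  have abc: "a < 0" "0 < b" "0 < c" using assms by (auto simp: a_def b_def c_def)
  define x y where "x = a / (a - b)" and "y = a / (a - c)"
  have xy: "0 < x" "x < 1" "0 < y" "y < 1" using abc by (auto simp: x_def y_def field_simps)
  have bx: "(b - a) * x = - a" and cy: "(c - a) * y = - a"
    using abc by (auto simp: x_def y_def field_simps)
  define X Y where "X = A + x *\<^sub>R (B - A)" and "Y = A + y *\<^sub>R (C - A)"
  have bX: "(b - a) *\<^sub>R X = b *\<^sub>R A - a *\<^sub>R B"
  proof -
    have "(b - a) *\<^sub>R X = (b - a) *\<^sub>R A + ((b - a) * x) *\<^sub>R (B - A)"
      by (simp add: X_def scaleR_add_right)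
    then show ?thesis unfolding bx by (simp add: algebra_simps)
  qed
  have cY: "(c - a) *\<^sub>R Y = c *\<^sub>R A - a *\<^sub>R C"
  proof -
    have "(c - a) *\<^sub>R Y = (c - a) *\<^sub>R A + ((c - a) * y) *\<^sub>R (C - A)"
      by (simp add: Y_def scaleR_add_right)
    then show ?thesis unfolding cy by (simp add: algebra_simps)
  qed
  let ?S = "convex hull {A, B, C} \<inter> {x. 0 \<le> w \<bullet> x}"
  have "?S \<subseteq> convex hull {X, Y, B, C}"
  proof
    fix p assume p: "p \<in> ?S"
    then obtain u v z where uvz: "0 \<le> u" "0 \<le> v" "0 \<le> z" "u + v + z = 1"
      and p_eq: "p = u *\<^sub>R A + v *\<^sub>R B + z *\<^sub>R C"
      unfolding convex_hull_3 by auto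
    \<comment> \<open>The weight \<open>u\<close> of \<open>A\<close> is passed to \<open>X\<close>
      and \<open>Y\<close> in the ratio \<open>v * b\<close> to \<open>z * c\<close>. The sum
      \<open>T\<close> of these vanishes only for \<open>p = A\<close>, which is below the
      line.\<close>
    define T where "T = v * b + z * c"
    define g where "g = u * a + T"
    have g: "0 \<le> g" using p p_eq by (simp add: g_def T_def a_def b_def c_def inner_simps)
    have "T \<noteq> 0"
    proof
      assume "T = 0"
      then have "v * b = 0" "z * c = 0"
        using uvz abc by (auto simp: T_def add_nonneg_eq_0_iff)
      then have "u = 1" using abc uvz by simp
      then show False using g abc \<open>T = 0\<close> by (simp add: g_def)
    qed
    moreover have "0 \<le> T" using uvz abc by (simp add: T_def)
    ultimately have T: "0 < T" by simp
    show "p \<in> convex hull {X, Y, B, C}"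
    proof (rule in_convex_hull_4I)
      show "0 \<le> u * v * (b - a) / T" "0 \<le> u * z * (c - a) / T" "0 \<le> v * g / T" "0 \<le> z * g / T"
        using uvz abc g T by auto
      have "u * v * (b - a) + u * z * (c - a) + v * g + z * g = (u + v + z) * T"
        by (simp add: g_def T_def algebra_simps)
      then show "u * v * (b - a) / T + u * z * (c - a) / T + v * g / T + z * g / T = 1"
        using T uvz by (simp flip: add_divide_distrib)
      have "T *\<^sub>R p = (u * v) *\<^sub>R (b *\<^sub>R A - a *\<^sub>R B) + (u * z) *\<^sub>R (c *\<^sub>R A - a *\<^sub>R C)
          + (v * g) *\<^sub>R B + (z * g) *\<^sub>R C"
        by (simp add: p_eq g_def T_def algebra_simps)
      also have "\<dots> = (u * v) *\<^sub>R ((b - a) *\<^sub>R X) + (u * z) *\<^sub>R ((c - a) *\<^sub>R Y)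
          + (v * g) *\<^sub>R B + (z * g) *\<^sub>R C"
        by (simp only: bX cY)
      also have "\<dots> = T *\<^sub>R ((u * v * (b - a) / T) *\<^sub>R X + (u * z * (c - a) / T) *\<^sub>R Y
          + (v * g / T) *\<^sub>R B + (z * g / T) *\<^sub>R C)"
        using T by (simp add: scaleR_add_right)
      finally show "p = (u * v * (b - a) / T) *\<^sub>R X + (u * z * (c - a) / T) *\<^sub>R Y
          + (v * g / T) *\<^sub>R B + (z * g / T) *\<^sub>R C"
        using T by (simp only: scaleR_cancel_left) simp
    qed
  qed
  moreover have "convex hull {X, Y, B, C} \<subseteq> ?S"
  proof (rule hull_minimal)
    have "X \<in> convex hull {A, B, C}"
      by (rule in_convex_hull_3I[of "1 - x" x 0]) (use xy in \<open>auto simp: X_def algebra_simps\<close>)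
    moreover have "Y \<in> convex hull {A, B, C}"
      by (rule in_convex_hull_3I[of "1 - y" 0 y]) (use xy in \<open>auto simp: Y_def algebra_simps\<close>)
    moreover have "w \<bullet> X = a + (b - a) * x" "w \<bullet> Y = a + (c - a) * y"
      by (auto simp: X_def Y_def inner_simps a_def b_def c_def algebra_simps)
    moreover have "B \<in> convex hull {A, B, C}" "C \<in> convex hull {A, B, C}" by (simp_all add: hull_inc)
    ultimately show "{X, Y, B, C} \<subseteq> ?S" using B C bx cy by auto
    show "convex ?S" by (intro convex_Int convex_convex_hull convex_halfspace_ge)
  qed
  ultimately have S: "?S = convex hull {X, Y, B, C}" by blast
  have fB: "f \<bullet> B = f \<bullet> A + 1" and fC: "f \<bullet> C = f \<bullet> A"
    and hB: "h \<bullet> B = h \<bullet> A" and hC: "h \<bullet> C = h \<bullet> A + 1"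
    using f h by (auto simp: inner_diff_right)
  have fX: "f \<bullet> X = f \<bullet> A + x" and fY: "f \<bullet> Y = f \<bullet> A"
    and hX: "h \<bullet> X = h \<bullet> A" and hY: "h \<bullet> Y = h \<bullet> A + y"
    using f h by (auto simp: X_def Y_def inner_add_right)
  have nB: "B \<notin> convex hull {X, Y, C}"
    by (rule not_in_convex_hull_if_inner_less[of _ f]) (use xy fB fC fX fY in auto)
  have nC: "C \<notin> convex hull {X, Y, B}"
    by (rule not_in_convex_hull_if_inner_less[of _ h]) (use xy hB hC hX hY in auto)
  have pos: "x * y > 0" "y * y > 0" "x * x > 0" "x * y < y" "x * y < x" using xy by auto
  then have pos': "x * y < y + y * y" "x * y < x + x * x" by linarith+
  \<comment> \<open>In the coordinates, \<open>X = (x, 0)\<close>, \<open>Y = (0, y)\<close>,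
    \<open>B = (1, 0)\<close> and \<open>C = (0, 1)\<close>. The functional \<open>- h\<close> has a
    tie between \<open>X\<close> and \<open>B\<close>; the tilt by
    \<open>y *\<^sub>R (f + h)\<close> breaks it in favour of \<open>X\<close>.\<close>
  have nX: "X \<notin> convex hull {Y, B, C}"
    by (rule not_in_convex_hull_if_inner_less[of _ "- h - y *\<^sub>R (f + h)"])
      (use xy pos pos' fB fC fX fY hB hC hX hY in \<open>auto simp: inner_simps algebra_simps\<close>)
  have nY: "Y \<notin> convex hull {X, B, C}"
    by (rule not_in_convex_hull_if_inner_less[of _ "- f - x *\<^sub>R (f + h)"])
      (use xy pos pos' fB fC fX fY hB hC hX hY in \<open>auto simp: inner_simps algebra_simps\<close>)
  have ins: "v extreme_point_of ?S" if "{X, Y, B, C} = insert v V" "finite V" "v \<notin> convex hull V"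
    for v V unfolding S using that extreme_point_of_convex_hull_insert by metis
  have "X extreme_point_of ?S" by (rule ins[OF _ _ nX]) auto
  moreover have "Y extreme_point_of ?S" by (rule ins[OF _ _ nY]) auto
  moreover have "B extreme_point_of ?S" by (rule ins[OF _ _ nB]) auto
  moreover have "C extreme_point_of ?S" by (rule ins[OF _ _ nC]) auto
  moreover have "v \<in> {X, Y, B, C}" if "v extreme_point_of ?S" for v
    using that unfolding S by (rule extreme_point_of_convex_hull)
  ultimately have "{v. v extreme_point_of ?S} = {X, Y, B, C}" by auto
  moreover have "card {X, Y, B, C} = 4"
  proof -
    have "X \<notin> {Y, B, C}" "Y \<notin> {X, B, C}" "B \<notin> {X, Y, C}"
      using nX nY nB by (meson hull_inc)+
    then show ?thesis by auto
  qed
  moreover have "polytope ?S" unfolding S by (intro polytope_convex_hull) simp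
  ultimately show ?thesis by (simp add: quadrilateral_def)
qed


section \<open>The cells along a segment\<close>

text \<open>The determinant of the direction of the segment and \<open>(x, y)\<close>: positive
  above the line, negative below.\<close>

definition height :: "fraction \<Rightarrow> int \<Rightarrow> int \<Rightarrow> int" where
  "height t x y = int (snd t) * y - int (fst t) * x"

text \<open>Integer form of membership in \<open>squares\<close>: the line strictly separates the
  upper left from the lower right corner, and the bounds on \<open>i + j\<close> cut the line down
  to the segment.\<close>

definition path_square :: "fraction \<Rightarrow> int \<Rightarrow> int \<Rightarrow> bool" where
  "path_square t i j \<longleftrightarrow> 0 \<le> i + j \<and> i + j \<le> int (fst t) + int (snd t) - 2 \<and>
     0 < height t i (j + 1) \<and> height t (i + 1) j < 0"

text \<open>
  A horizontal or vertical edge belongs to the square above it or to its right: the square that the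
  segment enters through it.
\<close>

fun path_cell :: "fraction \<Rightarrow> cell \<Rightarrow> bool" where
  "path_cell t (Tri h i j) \<longleftrightarrow> path_square t i j"
| "path_cell t (Edge Diagonal i j) \<longleftrightarrow> path_square t i j"
| "path_cell t (Edge Horizontal i j) \<longleftrightarrow> path_square t i j \<and> 0 < height t i j"
| "path_cell t (Edge Vertical i j) \<longleftrightarrow> path_square t i j \<and> height t i j < 0"

text \<open>
  The segment meets cells of consecutive ranks. Unlike the position, the rank does not depend on
  the fraction, and it is compatible with translations.
\<close>

fun cell_rank :: "cell \<Rightarrow> int" where
  "cell_rank (Tri LowerLeft i j) = 4 * (i + j)"
| "cell_rank (Edge Diagonal i j) = 4 * (i + j) + 1"
| "cell_rank (Tri UpperRight i j) = 4 * (i + j) + 2"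
| "cell_rank (Edge d i j) = 4 * (i + j) - 1"

section \<open>Regions as systems of inequalities\<close>

lemma mem_region_LowerLeft:
  "(x, y) \<in> region (Tri LowerLeft i j) \<longleftrightarrow> i \<le> x \<and> j \<le> y \<and> x + y \<le> i + j + 1"
proof
  assume "(x, y) \<in> region (Tri LowerLeft i j)"
  then obtain u v w :: real where "0 \<le> u" "0 \<le> v" "0 \<le> w" "u + v + w = 1"
    and xy: "x = u * i + v * (i + 1) + w * i" "y = u * j + v * j + w * (j + 1)"
    by (auto simp: convex_hull_3 lattice_pt_def)
  moreover have "x = (u + v + w) * i + v" "y = (u + v + w) * j + w"
    by (auto simp: xy algebra_simps)
  ultimately show "i \<le> x \<and> j \<le> y \<and> x + y \<le> i + j + 1" by simp
next
  assume *: "i \<le> x \<and> j \<le> y \<and> x + y \<le> i + j + 1"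
  show "(x, y) \<in> region (Tri LowerLeft i j)"
    unfolding region.simps
    by (rule in_convex_hull_3I[of "i + j + 1 - x - y" "x - i" "y - j"])
      (use * in \<open>auto simp: lattice_pt_def algebra_simps\<close>)
qed

lemma mem_region_UpperRight:
  "(x, y) \<in> region (Tri UpperRight i j) \<longleftrightarrow> x \<le> i + 1 \<and> y \<le> j + 1 \<and> i + j + 1 \<le> x + y"
proof
  assume "(x, y) \<in> region (Tri UpperRight i j)"
  then obtain u v w :: real where "0 \<le> u" "0 \<le> v" "0 \<le> w" "u + v + w = 1"
    and xy: "x = u * (i + 1) + v * (i + 1) + w * i" "y = u * (j + 1) + v * j + w * (j + 1)"
    by (auto simp: convex_hull_3 lattice_pt_def)
  moreover have "x = (u + v + w) * (i + 1) - w" "y = (u + v + w) * (j + 1) - v"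
    by (auto simp: xy algebra_simps)
  ultimately show "x \<le> i + 1 \<and> y \<le> j + 1 \<and> i + j + 1 \<le> x + y" by simp
next
  assume *: "x \<le> i + 1 \<and> y \<le> j + 1 \<and> i + j + 1 \<le> x + y"
  show "(x, y) \<in> region (Tri UpperRight i j)"
    unfolding region.simps
    by (rule in_convex_hull_3I[of "x + y - i - j - 1" "j + 1 - y" "i + 1 - x"])
      (use * in \<open>auto simp: lattice_pt_def algebra_simps\<close>)
qed

lemma mem_region_Horizontal:
  "(x, y) \<in> region (Edge Horizontal i j) \<longleftrightarrow> y = j \<and> i \<le> x \<and> x \<le> i + 1"
proof -
  have "(x, y) \<in> region (Edge Horizontal i j) \<longleftrightarrow> y = j \<and> (\<exists>u :: real. 0 \<le> u \<and> u \<le> 1 \<and> x = i + u)"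
    by (auto simp: closed_segment_def lattice_pt_def algebra_simps)
  also have "(\<exists>u :: real. 0 \<le> u \<and> u \<le> 1 \<and> x = i + u) \<longleftrightarrow> i \<le> x \<and> x \<le> i + 1"
    by (auto intro: exI[of _ "x - i"])
  finally show ?thesis .
qed

lemma mem_region_Vertical:
  "(x, y) \<in> region (Edge Vertical i j) \<longleftrightarrow> x = i \<and> j \<le> y \<and> y \<le> j + 1"
proof -
  have "(x, y) \<in> region (Edge Vertical i j) \<longleftrightarrow> x = i \<and> (\<exists>u :: real. 0 \<le> u \<and> u \<le> 1 \<and> y = j + u)"
    by (auto simp: closed_segment_def lattice_pt_def algebra_simps)
  also have "(\<exists>u :: real. 0 \<le> u \<and> u \<le> 1 \<and> y = j + u) \<longleftrightarrow> j \<le> y \<and> y \<le> j + 1"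
    by (auto intro: exI[of _ "y - j"])
  finally show ?thesis .
qed

lemma mem_region_Diagonal:
  "(x, y) \<in> region (Edge Diagonal i j) \<longleftrightarrow> x + y = i + j + 1 \<and> i \<le> x \<and> x \<le> i + 1"
proof -
  have "(x, y) \<in> region (Edge Diagonal i j) \<longleftrightarrow>
      x + y = i + j + 1 \<and> (\<exists>u :: real. 0 \<le> u \<and> u \<le> 1 \<and> x = i + u)"
    by (auto simp: closed_segment_def lattice_pt_def algebra_simps)
  also have "(\<exists>u :: real. 0 \<le> u \<and> u \<le> 1 \<and> x = i + u) \<longleftrightarrow> i \<le> x \<and> x \<le> i + 1"
    by (auto intro: exI[of _ "x - i"])
  finally show ?thesis .
qed

lemmas mem_region = mem_region_LowerLeft mem_region_UpperRight mem_region_Horizontal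
  mem_region_Vertical mem_region_Diagonal

lemma mem_interior_unit_square:
  "(x, y) \<in> interior (unit_square i j) \<longleftrightarrow> i < x \<and> x < i + 1 \<and> j < y \<and> y < j + 1"
  by (auto simp: unit_square_def lattice_pt_def cbox_Pair_eq interior_Times)

declare region.simps [simp del]

lemma inner_lattice_pt: "(- real a, real b) \<bullet> lattice_pt i j = of_int (height (a, b) i j)"
  by (simp add: lattice_pt_def height_def algebra_simps)

lemma upper_half_eq: "upper_half (a, b) = {v. 0 \<le> (- real a, real b) \<bullet> v}"
  by (auto simp: upper_half_def)

text \<open>Midpoints are doubled to keep their heights integral.\<close>

fun double_mid :: "dir \<Rightarrow> int \<Rightarrow> int \<Rightarrow> int \<times> int" where
  "double_mid Horizontal i j = (2 * i + 1, 2 * j)"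
| "double_mid Vertical i j = (2 * i, 2 * j + 1)"
| "double_mid Diagonal i j = (2 * i + 1, 2 * j + 1)"

lemma edge_sign_eq:
  "edge_sign t d i j = (if 0 \<le> case_prod (height t) (double_mid d i j) then SMinus else SPlus)"
proof -
  define v where "v = midpoint (fst (edge_ends d i j)) (snd (edge_ends d i j))"
  have "v = (of_int (fst (double_mid d i j)) / 2, of_int (snd (double_mid d i j)) / 2)"
    by (cases d) (auto simp: v_def midpoint_def lattice_pt_def)
  then have "v \<in> upper_half t \<longleftrightarrow>
      real_of_int (int (fst t) * fst (double_mid d i j)) \<le> real_of_int (int (snd t) * snd (double_mid d i j))"
    by (simp add: upper_half_def)
  then have "v \<in> upper_half t \<longleftrightarrow> 0 \<le> case_prod (height t) (double_mid d i j)"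
    by (simp only: of_int_le_iff) (simp add: height_def case_prod_unfold)
  then show ?thesis by (simp add: edge_sign_def v_def)
qed

section \<open>Lattice points near the line of one segment\<close>

locale segment =
  fixes a b :: nat
  assumes a_pos: "0 < a" and b_pos: "0 < b" and coprime: "coprime a b"
begin

lemma mem_seg:
  fixes x y :: real
  shows "(x, y) \<in> seg (a, b) \<longleftrightarrow> b * y = a * x \<and> 0 \<le> x \<and> x \<le> b"
proof
  assume "(x, y) \<in> seg (a, b)"
  then obtain u :: real where "0 \<le> u" "u \<le> 1" "x = u * b" "y = u * a"
    by (auto simp: seg_def seg_end_def closed_segment_def)
  then show "b * y = a * x \<and> 0 \<le> x \<and> x \<le> b" using mult_right_mono[of u 1 "real b"] by simp
next
  assume *: "b * y = a * x \<and> 0 \<le> x \<and> x \<le> b"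
  have "0 \<le> x / b" "x / b \<le> 1" "(x, y) = (1 - x / b) *\<^sub>R (0, 0) + (x / b) *\<^sub>R (real b, real a)"
    using * b_pos by (auto simp: field_simps)
  then show "(x, y) \<in> seg (a, b)" unfolding seg_def seg_end_def closed_segment_def fst_conv snd_conv by blast
qed

lemma mem_seg_interior:
  fixes x y :: real
  shows "(x, y) \<in> seg_interior (a, b) \<longleftrightarrow> b * y = a * x \<and> 0 < x \<and> x < b"
proof -
  have "x = 0 \<and> y = 0 \<longleftrightarrow> x = 0" "x = b \<and> y = a \<longleftrightarrow> x = b" if "b * y = a * x"
    using that b_pos by auto
  then show ?thesis
    by (auto simp: seg_interior_def open_segment_def mem_seg seg_end_def simp flip: seg_def[of "(a, b)", unfolded seg_end_def, simplified])
qed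

lemma height_eq: "height (a, b) x y = int b * y - int a * x"
  by (simp add: height_def)

lemma height_eq_0:
  assumes "height (a, b) x y = 0"
  obtains m :: int where "x = m * b" "y = m * a"
proof -
  have eq: "int b * y = int a * x" using assms by (simp add: height_eq)
  then have "int b dvd int a * x" by (metis dvd_triv_left)
  then have "int b dvd x" using coprime by (simp add: coprime_dvd_mult_right_iff coprime_commute)
  then obtain m :: int where "x = m * b" by (auto simp: dvd_def mult.commute)
  moreover from this have "y = m * a" using eq b_pos by simp
  ultimately show thesis using that by blast
qed

text \<open>A lattice point on the line is an integer multiple of the end point, and the factor
  would lie strictly between 0 and 1. The versions for \<open>x\<close>, \<open>y\<close> and
  \<open>x + y\<close> serve vertical, horizontal and diagonal edges.\<close>

lemma height_neq_0: "0 < x \<Longrightarrow> x < int b \<Longrightarrow> height (a, b) x y \<noteq> 0"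
proof
  assume x: "0 < x" "x < int b" and "height (a, b) x y = 0"
  from this(3) obtain m :: int where "x = m * b" by (rule height_eq_0)
  with x have "0 < m" "m < 1" by (auto simp: zero_less_mult_iff)
  then show False by simp
qed

lemma height_neq_0':
  assumes "0 < y" "y < int a"
  shows "height (a, b) x y \<noteq> 0"
proof
  assume "height (a, b) x y = 0"
  then obtain m :: int where "y = m * a" by (rule height_eq_0)
  with assms have "0 < m" "m < 1" by (auto simp: zero_less_mult_iff)
  then show False by simp
qed

lemma height_neq_0_sum:
  assumes "0 < x + y" "x + y < int a + int b"
  shows "height (a, b) x y \<noteq> 0"
proof
  assume "height (a, b) x y = 0"
  then obtain m :: int where "x = m * b" "y = m * a" by (rule height_eq_0)
  then have "x + y = m * (int a + int b)" by (simp add: algebra_simps)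
  with assms have "0 < m" "m < 1" by (auto simp: zero_less_mult_iff)
  then show False by simp
qed

text \<open>The line increases, so a coordinate out of range drags the other one out in the same
  direction, and then \<open>i + j\<close> leaves its range.\<close>

lemma path_square_bounds:
  assumes "path_square (a, b) i j"
  shows "0 \<le> i" "i < b" "0 \<le> j" "j < a"
proof -
  have n: "0 \<le> i + j" "i + j \<le> int a + int b - 2"
    and u: "int a * i < int b * (j + 1)" "int b * j < int a * (i + 1)"
    using assms by (auto simp: path_square_def height_eq)
  have less: "y < z" if "int c * y < int c * z" for c y z
    using that by (simp add: mult_less_cancel_left)
  show "0 \<le> i"
  proof (rule ccontr)
    assume "\<not> 0 \<le> i"
    then have "int a * (i + 1) \<le> 0" by (intro mult_nonneg_nonpos) auto
    then have "int b * j < int b * 0" using u by simp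
    then have "j < 0" by (rule less)
    then show False using n \<open>\<not> 0 \<le> i\<close> by simp
  qed
  show "0 \<le> j"
  proof (rule ccontr)
    assume "\<not> 0 \<le> j"
    then have "int b * (j + 1) \<le> 0" by (intro mult_nonneg_nonpos) auto
    then have "int a * i < int a * 0" using u by simp
    then have "i < 0" by (rule less)
    then show False using n \<open>\<not> 0 \<le> j\<close> by simp
  qed
  show "i < b"
  proof (rule ccontr)
    assume "\<not> i < b"
    then have "int a * b \<le> int a * i" by (intro mult_left_mono) auto
    then have "int b * a < int b * (j + 1)" using u by (simp add: mult.commute)
    then have "a < j + 1" by (rule less)
    then show False using n \<open>\<not> i < b\<close> by simp
  qed
  show "j < a"
  proof (rule ccontr)
    assume "\<not> j < a"
    then have "int b * a \<le> int b * j" by (intro mult_left_mono) auto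
    then have "int a * b < int a * (i + 1)" using u by (simp add: mult.commute)
    then have "b < i + 1" by (rule less)
    then show False using n \<open>\<not> j < a\<close> by simp
  qed
qed

text \<open>If \<open>i' < i\<close> on the same antidiagonal, then \<open>(i, j + 1)\<close>, which
  is above the line, would lie weakly to the right of and below \<open>(i' + 1, j')\<close>, which
  is below the line.\<close>

lemma path_square_unique:
  assumes "path_square (a, b) i j" "path_square (a, b) i' j'" "i + j = i' + j'"
  shows "i = i'" "j = j'"
proof -
  have le: "i \<le> i'" if "path_square (a, b) i j" "path_square (a, b) i' j'" "i + j = i' + j'"
    for i j i' j'
  proof (rule ccontr)
    assume "\<not> i \<le> i'"
    then have "int a * (i' + 1) \<le> int a * i" "int b * (j + 1) \<le> int b * j'"
      using that(3) by (auto intro!: mult_left_mono)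
    then show False using that(1,2) by (simp add: path_square_def height_eq)
  qed
  show "i = i'" using le[OF assms] le[OF assms(2,1) assms(3)[symmetric]] by simp
  then show "j = j'" using assms(3) by simp
qed

section \<open>Abscissas at which the line meets the grid\<close>

definition row_x :: "int \<Rightarrow> real" where
  "row_x j = real b * of_int j / real a"

text \<open>The line meets \<open>x + y = n + 1\<close> here; this line carries the diagonals of the
  squares with \<open>i + j = n\<close>.\<close>

definition diag_x :: "int \<Rightarrow> real" where
  "diag_x n = real b * (of_int n + 1) / (real a + real b)"

lemma row_x_le_iff:
  fixes x y :: real
  assumes "b * y = a * x"
  shows "row_x j \<le> x \<longleftrightarrow> j \<le> y"
  using assms a_pos b_pos mult_le_cancel_left_pos[of "real b" "real_of_int j" y]
  by (simp add: row_x_def field_simps)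

lemma le_row_x_iff:
  fixes x y :: real
  assumes "b * y = a * x"
  shows "x \<le> row_x j \<longleftrightarrow> y \<le> j"
  using assms a_pos b_pos mult_le_cancel_left_pos[of "real b" y "real_of_int j"]
  by (simp add: row_x_def field_simps)

lemma diag_x_le_iff:
  fixes x y :: real
  assumes "b * y = a * x"
  shows "diag_x n \<le> x \<longleftrightarrow> n + 1 \<le> x + y"
  using assms a_pos b_pos mult_le_cancel_left_pos[of "real b" "real_of_int n + 1" "x + y"]
  by (simp add: diag_x_def field_simps)

lemma le_diag_x_iff:
  fixes x y :: real
  assumes "b * y = a * x"
  shows "x \<le> diag_x n \<longleftrightarrow> x + y \<le> n + 1"
  using assms a_pos b_pos mult_le_cancel_left_pos[of "real b" "x + y" "real_of_int n + 1"]
  by (simp add: diag_x_def field_simps)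

lemma row_x_mono: "j \<le> j' \<Longrightarrow> row_x j \<le> row_x j'"
  using a_pos by (simp add: row_x_def divide_right_mono mult_left_mono)

lemma diag_x_mono: "n \<le> m \<Longrightarrow> diag_x n \<le> diag_x m"
  by (simp add: diag_x_def divide_right_mono mult_left_mono)

lemma less_row_x_iff: "of_int i < row_x j \<longleftrightarrow> 0 < height (a, b) i j"
proof -
  have "i < row_x j \<longleftrightarrow> real_of_int (int a * i) < real_of_int (int b * j)"
    using a_pos by (simp add: row_x_def field_simps)
  then show ?thesis by (simp only: of_int_less_iff height_eq) simp
qed

lemma row_x_less_iff: "row_x j < of_int i \<longleftrightarrow> height (a, b) i j < 0"
proof -
  have "row_x j < i \<longleftrightarrow> real_of_int (int b * j) < real_of_int (int a * i)"
    using a_pos by (simp add: row_x_def field_simps)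
  then show ?thesis by (simp only: of_int_less_iff height_eq) simp
qed

text \<open>On the line, the point on a diagonal is a weighted mean of the points on a row and a column.\<close>

lemma diag_x_row_x:
  fixes i j :: int
  shows "(a + b) * diag_x (i + j - 1) = b * i + a * row_x j"
  using a_pos b_pos by (simp add: diag_x_def row_x_def field_simps)

lemma diag_x_between:
  fixes i j :: int
  shows "i < row_x j \<Longrightarrow> i < diag_x (i + j - 1) \<and> diag_x (i + j - 1) < row_x j"
  "row_x j < i \<Longrightarrow> row_x j < diag_x (i + j - 1) \<and> diag_x (i + j - 1) < i"
  "row_x j = i \<Longrightarrow> diag_x (i + j - 1) = i"
proof -
  define z where "z = diag_x (i + j - 1)"
  have z: "a * (z - row_x j) = b * (i - z)"
    using diag_x_row_x[of i j] by (simp add: z_def algebra_simps)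
  have pos: "a * x > 0 \<longleftrightarrow> x > 0" "b * x > 0 \<longleftrightarrow> x > 0" "a * x = 0 \<longleftrightarrow> x = 0"
     "a * x < 0 \<longleftrightarrow> x < 0" "b * x < 0 \<longleftrightarrow> x < 0" for x :: real
    using a_pos b_pos by (auto simp: zero_less_mult_iff mult_less_0_iff)
  have sgn: "z - row_x j > 0 \<longleftrightarrow> i - z > 0" "z - row_x j < 0 \<longleftrightarrow> i - z < 0"
    using z pos by metis+
  show "i < row_x j \<Longrightarrow> i < diag_x (i + j - 1) \<and> diag_x (i + j - 1) < row_x j"
    using sgn unfolding z_def[symmetric] by linarith
  show "row_x j < i \<Longrightarrow> row_x j < diag_x (i + j - 1) \<and> diag_x (i + j - 1) < i"
    using sgn unfolding z_def[symmetric] by linarith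
  show "row_x j = i \<Longrightarrow> diag_x (i + j - 1) = i"
    using sgn unfolding z_def[symmetric] by linarith
qed

text \<open>\<open>diag_x_between\<close> at the four corners: the upper left and lower right ones
  lie on the diagonal of the square, the other two on the neighbouring diagonals.\<close>

lemma path_square_diag_x:
  assumes "path_square (a, b) i j"
  shows "i < diag_x (i + j)" "row_x j < diag_x (i + j)"
    "diag_x (i + j) < of_int i + 1" "diag_x (i + j) < row_x (j + 1)"
    "diag_x (i + j - 1) \<le> max (of_int i) (row_x j)"
    "min (of_int i + 1) (row_x (j + 1)) \<le> diag_x (i + j + 1)"
proof -
  have "i < row_x (j + 1)" "row_x j < i + 1"
    using assms less_row_x_iff[of i "j + 1"] row_x_less_iff[of j "i + 1"]
    by (auto simp: path_square_def)
  then show "i < diag_x (i + j)" "row_x j < diag_x (i + j)"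
    "diag_x (i + j) < of_int i + 1" "diag_x (i + j) < row_x (j + 1)"
    using diag_x_between(1)[of i "j + 1"] diag_x_between(2)[of j "i + 1"]
    by (auto simp: algebra_simps)
  show "diag_x (i + j - 1) \<le> max (of_int i) (row_x j)"
    using diag_x_between[where i = i and j = j] by linarith
  show "min (of_int i + 1) (row_x (j + 1)) \<le> diag_x (i + j + 1)"
    using diag_x_between[where i = "i + 1" and j = "j + 1"] by (simp add: algebra_simps) linarith
qed

section \<open>Squares and cells met by the segment\<close>

lemma squares_eq: "squares (a, b) = {(i, j). path_square (a, b) i j}"
proof -
  have "(i, j) \<in> squares (a, b) \<longleftrightarrow> path_square (a, b) i j" for i j
  proof
    assume "(i, j) \<in> squares (a, b)"
    then obtain x y :: real where xy: "i < x" "x < i + 1" "j < y" "y < j + 1"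
        "b * y = a * x" "0 \<le> x" "x \<le> b"
      by (auto simp: squares_def mem_interior_unit_square mem_seg)
    have "y \<le> a" "0 \<le> y"
    proof -
      have "real b * y \<le> real b * real a" "real b * 0 \<le> real b * y"
        using xy by (auto simp: mult.commute[of _ "real a"] mult_left_mono)
      then show "y \<le> a" "0 \<le> y" using b_pos by (simp_all add: zero_le_mult_iff)
    qed
    have "x \<le> row_x (j + 1)" "row_x j \<le> x" 
      using xy le_row_x_iff[of y x "j + 1"] row_x_le_iff[of y x j] by auto
    then have "0 < height (a, b) i (j + 1)" "height (a, b) (i + 1) j < 0"
      using xy less_row_x_iff[of i "j + 1"] row_x_less_iff[of j "i + 1"] by auto
    moreover have "0 \<le> i" "0 \<le> j" "i < b" "j < a" using xy \<open>y \<le> a\<close> \<open>0 \<le> y\<close> by linarith+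
    ultimately show "path_square (a, b) i j" by (simp add: path_square_def)
  next
    assume sq: "path_square (a, b) i j"
    \<comment> \<open>The line meets the diagonal of the square in an interior point of the
      square.\<close>
    define x where "x = diag_x (i + j)"
    define y where "y = a * x / b"
    have line: "b * y = a * x" using b_pos by (simp add: y_def)
    have x: "i < x" "row_x j < x" "x < i + 1" "x < row_x (j + 1)"
      using path_square_diag_x[OF sq] by (auto simp: x_def)
    then have "j < y" "y < j + 1"
      using le_row_x_iff[OF line, of j] row_x_le_iff[OF line, of "j + 1"] by auto
    moreover have "0 \<le> x" "x \<le> b" using path_square_bounds[OF sq] x by linarith+
    ultimately have "(x, y) \<in> interior (unit_square i j) \<inter> seg (a, b)"
      using x line by (simp add: mem_interior_unit_square mem_seg)
    then show "(i, j) \<in> squares (a, b)" by (auto simp: squares_def)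
  qed
  then show ?thesis by auto
qed

lemma triangles_eq: "triangles (a, b) = {c. is_Tri c \<and> path_cell (a, b) c}"
proof -
  have "c \<in> triangles (a, b) \<longleftrightarrow> is_Tri c \<and> path_cell (a, b) c" for c
  proof (cases c)
    case (Tri h i j)
    then show ?thesis by (cases h) (auto simp: triangles_def squares_eq)
  qed (auto simp: triangles_def)
  then show ?thesis by auto
qed

lemma seg_interior_bounds:
  fixes x y :: real
  assumes "b * y = a * x" "0 < x" "x < b"
  shows "0 < y" "y < a"
proof -
  have "0 < real b * y" "real b * y < real b * a"
    using assms a_pos by (auto simp: mult.commute[of _ "real a"])
  then show "0 < y" "y < a" using b_pos by (auto simp: zero_less_mult_iff)
qed

lemma height_nonneg:
  fixes x y :: real
  assumes "b * y = a * x" "i \<le> x" "y \<le> j"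
  shows "0 \<le> height (a, b) i j"
proof -
  have "x \<le> row_x j" using le_row_x_iff[OF assms(1)] assms(3) by simp
  then show ?thesis using row_x_less_iff[of j i] assms(2) by linarith
qed

lemma height_nonpos:
  fixes x y :: real
  assumes "b * y = a * x" "x \<le> i" "j \<le> y"
  shows "height (a, b) i j \<le> 0"
proof -
  have "row_x j \<le> x" using row_x_le_iff[OF assms(1)] assms(3) by simp
  then show ?thesis using less_row_x_iff[of i j] assms(2) by linarith
qed

text \<open>The ends of a crossed edge lie weakly on opposite sides of the line, and strictly since
  the segment has no inner lattice points. For a horizontal (vertical) edge, the other corner of the
  square comes from one step up (right).\<close>

lemma crossed_edges_iff:
  "Edge d i j \<in> crossed_edges (a, b) \<longleftrightarrow> path_cell (a, b) (Edge d i j)" (is "?L \<longleftrightarrow> ?R")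
proof
  assume ?L
  then obtain x y :: real where reg: "(x, y) \<in> region (Edge d i j)"
    and xy: "b * y = a * x" "0 < x" "x < b"
    by (auto simp: crossed_edges_def mem_seg_interior)
  note y = seg_interior_bounds[OF xy]
  note nonneg = height_nonneg[OF xy(1)] and nonpos = height_nonpos[OF xy(1)]
  have left: "height (a, b) i (j + 1) = height (a, b) i j + b"
    and right: "height (a, b) (i + 1) j = height (a, b) i j - a"
    by (auto simp: height_eq algebra_simps)
  show ?R
  proof (cases d)
    case Horizontal
    then have e: "y = j" "i \<le> x" "x \<le> i + 1" using reg by (auto simp: mem_region)
    have j: "0 < j" "j < a" and i: "0 \<le> i" "i < b" using y e xy by auto
    have "0 < height (a, b) i j" "height (a, b) (i + 1) j < 0"
      using nonneg[of i j] nonpos[of "i + 1" j] e j height_neq_0'[of j i] height_neq_0'[of j "i + 1"]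
      by auto
    then show ?thesis using Horizontal i j left by (simp add: path_square_def)
  next
    case Vertical
    then have e: "x = i" "j \<le> y" "y \<le> j + 1" using reg by (auto simp: mem_region)
    have j: "0 \<le> j" "j < a" and i: "0 < i" "i < b" using y e xy by auto
    have "height (a, b) i j < 0" "0 < height (a, b) i (j + 1)"
      using nonpos[of i j] nonneg[of i "j + 1"] e i height_neq_0[of i j] height_neq_0[of i "j + 1"]
      by auto
    then show ?thesis using Vertical i j right by (simp add: path_square_def)
  next
    case Diagonal
    then have e: "x + y = i + j + 1" "i \<le> x" "x \<le> i + 1" using reg by (auto simp: mem_region)
    have ij: "0 < i + j + 1" "i + j + 1 < int a + int b" using y e xy by auto
    have "0 < height (a, b) i (j + 1)" "height (a, b) (i + 1) j < 0"
      using nonneg[of i "j + 1"] nonpos[of "i + 1" j] e ij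
        height_neq_0_sum[of i "j + 1"] height_neq_0_sum[of "i + 1" j] by auto
    then show ?thesis using Diagonal ij by (simp add: path_square_def)
  qed
next
  assume ?R
  then have sq: "path_square (a, b) i j" by (cases d) auto
  note bnd = path_square_bounds[OF sq]
  have sq_x: "i < row_x (j + 1)" "row_x j < i + 1"
    using sq less_row_x_iff[of i "j + 1"] row_x_less_iff[of j "i + 1"] by (auto simp: path_square_def)
  define x where "x = (case d of Horizontal \<Rightarrow> row_x j | Vertical \<Rightarrow> of_int i | Diagonal \<Rightarrow> diag_x (i + j))"
  define y where "y = real a * x / real b"
  have line: "b * y = a * x" using b_pos by (simp add: y_def)
  have "(x, y) \<in> region (Edge d i j) \<and> 0 < x \<and> x < b"
  proof (cases d)
    case Horizontal
    then have "x = row_x j" "i < row_x j" using \<open>?R\<close> less_row_x_iff[of i j] by (auto simp: x_def)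
    moreover have "y = j"
      using \<open>x = row_x j\<close> row_x_le_iff[OF line, of j] le_row_x_iff[OF line, of j] by simp
    ultimately show ?thesis using Horizontal sq_x bnd by (auto simp: mem_region)
  next
    case Vertical
    then have x: "x = i" "row_x j < i" using \<open>?R\<close> row_x_less_iff[of j i] by (auto simp: x_def)
    then have "j \<le> y" "y \<le> j + 1"
      using sq_x row_x_le_iff[OF line, of j] le_row_x_iff[OF line, of "j + 1"] by auto
    moreover have "0 \<le> row_x j" using bnd by (simp add: row_x_def)
    then have "0 < i" using x by linarith
    ultimately show ?thesis using Vertical bnd x by (auto simp: mem_region)
  next
    case Diagonal
    then have x: "x = diag_x (i + j)" by (simp add: x_def)
    then have "x + y = i + j + 1"
      using diag_x_le_iff[OF line, of "i + j"] le_diag_x_iff[OF line, of "i + j"] by simp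
    then show ?thesis using Diagonal bnd path_square_diag_x[OF sq] x by (auto simp: mem_region)
  qed
  moreover have "Edge d i j \<in> edges (a, b)"
    unfolding edges_def
    by (rule UN_I[of "(i, j)"]) (use sq in \<open>cases d; simp add: squares_eq\<close>)+
  moreover have "(x, y) \<in> seg_interior (a, b)" using calculation line by (simp add: mem_seg_interior)
  ultimately show ?L by (auto simp: crossed_edges_def)
qed

lemma cells_eq: "triangles (a, b) \<union> crossed_edges (a, b) = {c. path_cell (a, b) c}"
proof -
  have "c \<in> triangles (a, b) \<union> crossed_edges (a, b) \<longleftrightarrow> path_cell (a, b) c" for c
    by (cases c) (auto simp: triangles_eq crossed_edges_iff, auto simp: crossed_edges_def edges_def)
  then show ?thesis by auto
qed

section \<open>Order of the cells along the segment\<close>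

fun entry_x :: "cell \<Rightarrow> real" where
  "entry_x (Tri LowerLeft i j) = max (of_int i) (row_x j)"
| "entry_x (Tri UpperRight i j) = diag_x (i + j)"
| "entry_x (Edge Horizontal i j) = row_x j"
| "entry_x (Edge Vertical i j) = of_int i"
| "entry_x (Edge Diagonal i j) = diag_x (i + j)"

text \<open>The segment leaves the upper right triangle at the first of two grid lines, hence the
  minimum; the maximum in \<open>entry_x\<close> is dual. An edge is met in one point, so both
  functions agree on it.\<close>

fun exit_x :: "cell \<Rightarrow> real" where
  "exit_x (Tri LowerLeft i j) = diag_x (i + j)"
| "exit_x (Tri UpperRight i j) = min (of_int i + 1) (row_x (j + 1))"
| "exit_x (Edge Horizontal i j) = row_x j"
| "exit_x (Edge Vertical i j) = of_int i"
| "exit_x (Edge Diagonal i j) = diag_x (i + j)"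

text \<open>On the line, each inequality that bounds the region becomes a bound on \<open>x\<close>
  alone; these bounds already keep \<open>x\<close> between 0 and \<open>b\<close>.\<close>

lemma mem_region_seg:
  fixes x y :: real
  assumes "path_cell (a, b) c"
  shows "(x, y) \<in> region c \<inter> seg (a, b) \<longleftrightarrow> b * y = a * x \<and> entry_x c \<le> x \<and> x \<le> exit_x c"
proof (cases "b * y = a * x")
  case line: True
  obtain i j where sq: "path_square (a, b) i j" and c: "(\<exists>h. c = Tri h i j) \<or> (\<exists>d. c = Edge d i j)"
    using assms by (cases c rule: entry_x.cases) auto
  note bnd = path_square_bounds[OF sq]
  note dx = path_square_diag_x[OF sq]
  have sq_x: "i < row_x (j + 1)" "row_x j < i + 1"
    using sq less_row_x_iff[of i "j + 1"] row_x_less_iff[of j "i + 1"] by (auto simp: path_square_def)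
  have row_a: "row_x j \<le> b"
    using bnd row_x_mono[of j a] a_pos by (simp add: row_x_def)
  have row_0: "0 \<le> row_x j"
    using bnd by (simp add: row_x_def)
  note iffs = row_x_le_iff[OF line] le_row_x_iff[OF line] diag_x_le_iff[OF line] le_diag_x_iff[OF line]
  have eq: "y = j \<longleftrightarrow> x = row_x j"
    using iffs(1)[of j] iffs(2)[of j] by linarith
  have eqd: "x + y = i + j + 1 \<longleftrightarrow> x = diag_x (i + j)"
    using iffs(3)[of "i + j"] iffs(4)[of "i + j"] by auto
  show ?thesis
  proof (cases c rule: entry_x.cases)
    case (1 i' j')
    with c have [simp]: "i' = i" "j' = j" by auto
    show ?thesis using 1 line bnd dx iffs(1)[of j] iffs(4)[of "i + j"] by (auto simp: mem_region mem_seg)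
  next
    case (5 i' j')
    with c have [simp]: "i' = i" "j' = j" by auto
    show ?thesis using 5 line bnd dx eqd by (auto simp: mem_region mem_seg)
  next
    case (2 i' j')
    with c have [simp]: "i' = i" "j' = j" by auto
    show ?thesis using 2 line bnd dx iffs(2)[of "j + 1"] iffs(3)[of "i + j"] by (auto simp: mem_region mem_seg)
  next
    case (3 i' j')
    with c have [simp]: "i' = i" "j' = j" by auto
    have "i < row_x j" using assms 3 less_row_x_iff[of i j] by simp
    then show ?thesis using 3 line bnd eq sq_x row_a row_0 by (auto simp: mem_region mem_seg)
  next
    case (4 i' j')
    with c have [simp]: "i' = i" "j' = j" by auto
    have "row_x j < i" using assms 4 row_x_less_iff[of j i] by simp
    then show ?thesis using 4 line bnd sq_x iffs(1)[of j] iffs(2)[of "j + 1"]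
      by (auto simp: mem_region mem_seg)
  qed
qed (auto simp: mem_seg)


lemma Tri_entry_less_exit:
  assumes "path_square (a, b) i j"
  shows "entry_x (Tri h i j) < exit_x (Tri h i j)"
  using path_square_diag_x[OF assms] by (cases h) auto

lemma entry_le_exit: "path_cell (a, b) c \<Longrightarrow> entry_x c \<le> exit_x c"
  by (cases c rule: entry_x.cases) (use path_square_diag_x in \<open>auto simp: less_imp_le\<close>)

lemma position_eq:
  assumes "path_cell (a, b) c"
  shows "position (a, b) c = (entry_x c + exit_x c) / 2"
proof -
  have "fst ` (region c \<inter> seg (a, b)) = {entry_x c..exit_x c}"
  proof (intro equalityI subsetI)
    fix x assume "x \<in> {entry_x c..exit_x c}"
    then have "(x, real a * x / real b) \<in> region c \<inter> seg (a, b)"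
      using mem_region_seg[OF assms] b_pos by simp
    then show "x \<in> fst ` (region c \<inter> seg (a, b))" by (metis fst_conv image_eqI)
  next
    fix x assume "x \<in> fst ` (region c \<inter> seg (a, b))"
    then obtain y where "(x, y) \<in> region c \<inter> seg (a, b)" by force
    then show "x \<in> {entry_x c..exit_x c}" using mem_region_seg[OF assms] by simp
  qed
  then show ?thesis using entry_le_exit[OF assms] by (simp add: position_def)
qed

lemma diag_x_strict_mono: "n < m \<Longrightarrow> diag_x n < diag_x m"
  using b_pos by (simp add: diag_x_def divide_strict_right_mono)

text \<open>
  The cells of level \<open>m\<close> are those that the segment meets after leaving the diagonal \<open>x + y = m\<close>,
  up to and including the diagonal edge on \<open>x + y = m + 1\<close>.
\<close>

fun level :: "cell \<Rightarrow> int" where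
  "level (Tri UpperRight i j) = i + j + 1"
| "level (Tri LowerLeft i j) = i + j"
| "level (Edge d i j) = i + j"

lemma level_mono: "cell_rank c < cell_rank c' \<Longrightarrow> level c \<le> level c'"
  by (cases c rule: entry_x.cases; cases c' rule: entry_x.cases) auto

text \<open>A triangle may touch a bounding diagonal, but its section is nondegenerate and the
  midpoint stays strictly inside. Only a diagonal edge attains the upper bound.\<close>

lemma position_bounds:
  assumes "path_cell (a, b) c"
  shows "diag_x (level c - 1) < position (a, b) c"
    "if \<exists>i j. c = Edge Diagonal i j then position (a, b) c = diag_x (level c)
     else position (a, b) c < diag_x (level c)"
proof -
  note pos = position_eq[OF assms]
  have "diag_x (level c - 1) < position (a, b) c \<and>
    (if \<exists>i j. c = Edge Diagonal i j then position (a, b) c = diag_x (level c)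
     else position (a, b) c < diag_x (level c))"
  proof (cases c rule: entry_x.cases)
    case (1 i j)
    then show ?thesis using pos assms path_square_diag_x[of i j] by auto
  next
    case (2 i j)
    then show ?thesis using pos assms path_square_diag_x[of i j] by auto
  next
    case (3 i j)
    then show ?thesis
      using pos assms path_square_diag_x[of i j] less_row_x_iff[of i j] diag_x_between(1)[of i j] by auto
  next
    case (4 i j)
    then show ?thesis
      using pos assms path_square_diag_x[of i j] row_x_less_iff[of j i] diag_x_between(2)[of j i] by auto
  next
    case (5 i j)
    then show ?thesis using pos diag_x_strict_mono[of "i + j - 1" "i + j"] by auto
  qed
  then show "diag_x (level c - 1) < position (a, b) c"
    "if \<exists>i j. c = Edge Diagonal i j then position (a, b) c = diag_x (level c)
     else position (a, b) c < diag_x (level c)" by auto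
qed

text \<open>Within a level, ranks put upper right triangles first, then horizontal and vertical
  edges, then lower left triangles. The level fixes the coordinate sums, which places the later cell
  far enough to the right or up. That one of the two is a triangle excludes two single points at the
  same place.\<close>

lemma exit_le_entry:
  assumes "path_cell (a, b) c" "path_cell (a, b) c'" "level c = level c'" "cell_rank c < cell_rank c'"
    and "\<nexists>i j. c' = Edge Diagonal i j"
  shows "exit_x c \<le> entry_x c' \<and> (is_Tri c \<or> is_Tri c')"
proof -
  have sq_x: "i < row_x (j + 1)" "row_x j < i + 1" if "path_square (a, b) i j" for i j
    using that less_row_x_iff[of i "j + 1"] row_x_less_iff[of j "i + 1"]
    by (auto simp: path_square_def)
  show ?thesis
  proof (cases c rule: entry_x.cases)
    case (1 i j)
    then show ?thesis using assms(3-5) by (cases c' rule: entry_x.cases) auto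
  next
    case (2 i j)
    show ?thesis
    proof (cases c' rule: entry_x.cases)
      case (1 i' j')
      \<comment> \<open>The coordinate sum grows by 1 from the upper right triangle to the next
        square, so at least one coordinate grows.\<close>
      then have "i + 1 \<le> i' \<or> j + 1 \<le> j'" using 2 assms(3) by auto
      then show ?thesis using 1 2 row_x_mono[of "j + 1" j'] by (auto simp: min_le_iff_disj le_max_iff_disj)
    next
      case (3 i' j')
      then have "i + 1 \<le> i' \<or> j + 1 \<le> j'" using 2 assms(3) by auto
      moreover have "i' < row_x j'" using 3 assms(2) less_row_x_iff[of i' j'] by simp
      ultimately show ?thesis using 2 3 row_x_mono[of "j + 1" j'] by (auto simp: min_le_iff_disj)
    next
      case (4 i' j')
      then have "i + 1 \<le> i' \<or> j + 1 \<le> j'" using 2 assms(3) by auto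
      moreover have "row_x j' < i'" using 4 assms(2) row_x_less_iff[of j' i'] by simp
      ultimately show ?thesis using 2 4 row_x_mono[of "j + 1" j'] by (auto simp: min_le_iff_disj)
    qed (use 2 assms(3-5) in auto)
  next
    case (3 i j)
    show ?thesis
    proof (cases c' rule: entry_x.cases)
      case (1 i' j')
      then have "i + 1 \<le> i' \<or> j \<le> j'" using 3 assms(3) by auto
      moreover have "row_x j < i + 1" using 3 assms(1) sq_x by simp
      ultimately show ?thesis using 1 3 row_x_mono[of j j'] by (auto simp: le_max_iff_disj)
    qed (use 3 assms(3-5) in auto)
  next
    case (4 i j)
    show ?thesis
    proof (cases c' rule: entry_x.cases)
      case (1 i' j')
      then have "i \<le> i' \<or> j + 1 \<le> j'" using 4 assms(3) by auto
      moreover have "i < row_x (j + 1)" using 4 assms(1) sq_x by simp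
      ultimately show ?thesis using 1 4 row_x_mono[of "j + 1" j'] by (auto simp: le_max_iff_disj)
    qed (use 4 assms(3-5) in auto)
  next
    case (5 i j)
    then show ?thesis using assms(3-5) by (cases c' rule: entry_x.cases) auto
  qed
qed

text \<open>Different levels are separated by a diagonal. In one level, a diagonal edge comes last;
  otherwise the sections are weakly ordered and one is nondegenerate, so the midpoints are strictly
  ordered.\<close>

lemma position_strict_mono:
  assumes c: "path_cell (a, b) c" and c': "path_cell (a, b) c'" and less: "cell_rank c < cell_rank c'"
  shows "position (a, b) c < position (a, b) c'"
proof (cases "level c < level c'")
  case True
  have "position (a, b) c \<le> diag_x (level c)" using position_bounds(2)[OF c] by (auto split: if_splits)
  also have "\<dots> \<le> diag_x (level c' - 1)" using True by (intro diag_x_mono) simp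
  also have "\<dots> < position (a, b) c'" by (rule position_bounds(1)[OF c'])
  finally show ?thesis .
next
  case False
  then have eq: "level c = level c'" using level_mono[OF less] by simp
  show ?thesis
  proof (cases "\<exists>i j. c' = Edge Diagonal i j")
    case True
    moreover have "\<nexists>i j. c = Edge Diagonal i j" using True eq less by auto
    ultimately show ?thesis using position_bounds(2)[OF c] position_bounds(2)[OF c'] eq by simp
  next
    case False
    have "exit_x c \<le> entry_x c'" "is_Tri c \<or> is_Tri c'"
      using exit_le_entry[OF c c' eq less False] by auto
    moreover have tri: "entry_x e < exit_x e" if "path_cell (a, b) e" "is_Tri e" for e
      using that Tri_entry_less_exit by (cases e) (simp_all only: path_cell.simps cell.disc)
    ultimately have "exit_x c \<le> entry_x c' \<and> (entry_x c < exit_x c \<or> entry_x c' < exit_x c')"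
      using tri[OF c] tri[OF c'] by blast
    then show ?thesis
      using entry_le_exit[OF c] entry_le_exit[OF c'] position_eq[OF c] position_eq[OF c'] by argo
  qed
qed

section \<open>Ranks determine the traversal\<close>

lemma rank_eq_imp_square_eq:
  assumes "path_cell (a, b) c" "path_cell (a, b) c'" "cell_rank c = cell_rank c'"
  obtains i j where "path_square (a, b) i j" "c \<in> range (\<lambda>h. Tri h i j) \<union> range (\<lambda>d. Edge d i j)"
    "c' \<in> range (\<lambda>h. Tri h i j) \<union> range (\<lambda>d. Edge d i j)"
proof -
  obtain i j where c: "path_square (a, b) i j" "c \<in> range (\<lambda>h. Tri h i j) \<union> range (\<lambda>d. Edge d i j)"
    using assms(1) by (cases c rule: entry_x.cases) auto
  obtain i' j' where c': "path_square (a, b) i' j'" "c' \<in> range (\<lambda>h. Tri h i' j') \<union> range (\<lambda>d. Edge d i' j')"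
    using assms(2) by (cases c' rule: entry_x.cases) auto
  \<comment> \<open>The four possible ranks for one value of \<open>i + j\<close> form a full
    residue system, so equal ranks force equal sums.\<close>
  have "4 * (i + j) - 1 \<le> cell_rank c" "cell_rank c \<le> 4 * (i + j) + 2"
    using c(2) by (cases c rule: entry_x.cases; auto)+
  moreover have "4 * (i' + j') - 1 \<le> cell_rank c'" "cell_rank c' \<le> 4 * (i' + j') + 2"
    using c'(2) by (cases c' rule: entry_x.cases; auto)+
  ultimately have "i + j = i' + j'" using assms(3) by presburger
  then show thesis using path_square_unique[OF c(1) c'(1)] c c' that by auto
qed

text \<open>Within one square only the lower and the left edge share a rank, and the sign of the
  height at the lower left corner admits at most one of them.\<close>

lemma rank_inj:
  assumes "path_cell (a, b) c" "path_cell (a, b) c'" "cell_rank c = cell_rank c'"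
  shows "c = c'"
proof -
  obtain i j where "c \<in> range (\<lambda>h. Tri h i j) \<union> range (\<lambda>d. Edge d i j)"
    "c' \<in> range (\<lambda>h. Tri h i j) \<union> range (\<lambda>d. Edge d i j)"
    using rank_eq_imp_square_eq[OF assms] by blast
  then show ?thesis using assms
    by (cases c rule: entry_x.cases; cases c' rule: entry_x.cases) auto
qed

lemma path_square_0: "path_square (a, b) 0 0"
  using a_pos b_pos by (simp add: path_square_def height_eq)

lemma rank_bounds:
  assumes "path_cell (a, b) c"
  shows "0 \<le> cell_rank c" "cell_rank c \<le> 4 * (int a + int b) - 6"
proof -
  obtain i j where sq: "path_square (a, b) i j"
    and c: "c \<in> range (\<lambda>h. Tri h i j) \<union> range (\<lambda>d. Edge d i j)"
    using assms(1) by (cases c rule: entry_x.cases) auto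
  have ij: "0 \<le> i + j" "i + j \<le> int a + int b - 2"
    using sq by (auto simp: path_square_def)
  \<comment> \<open>Only a horizontal or vertical edge of the starting square could have rank
    \<open>- 1\<close>. That square is entered at its corner, of height 0, and not through an
    edge.\<close>
  have "0 < i + j" if "height (a, b) i j \<noteq> 0"
  proof (rule ccontr)
    assume "\<not> 0 < i + j"
    then have "i = 0" "j = 0" using path_square_unique[OF sq path_square_0] ij by auto
    then show False using that by (simp add: height_eq)
  qed
  then show "0 \<le> cell_rank c"
    using c ij assms by (cases c rule: entry_x.cases) auto
  show "cell_rank c \<le> 4 * (int a + int b) - 6"
    using c ij by (cases c rule: entry_x.cases) auto
qed

lemma finite_path_cells: "finite {c. path_cell (a, b) c}"
proof (rule finite_imageD)
  show "finite (cell_rank ` {c. path_cell (a, b) c})"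
    by (rule finite_subset[of _ "{0..4 * (int a + int b) - 6}"]) (use rank_bounds in auto)
  show "inj_on cell_rank {c. path_cell (a, b) c}" using rank_inj by (auto intro: inj_onI)
qed

lemma position_less_iff:
  assumes "path_cell (a, b) c" "path_cell (a, b) c'"
  shows "position (a, b) c < position (a, b) c' \<longleftrightarrow> cell_rank c < cell_rank c'"
proof
  assume less: "position (a, b) c < position (a, b) c'"
  show "cell_rank c < cell_rank c'"
  proof (rule ccontr)
    assume "\<not> cell_rank c < cell_rank c'"
    then consider "cell_rank c = cell_rank c'" | "cell_rank c' < cell_rank c" by linarith
    then show False
      using less position_strict_mono[OF assms(2,1)] rank_inj[OF assms] by cases auto
  qed
qed (rule position_strict_mono[OF assms])

text \<open>Positions and ranks order the cells alike. A candidate for the traversal thus needs only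
  the right set of cells and increasing ranks.\<close>

lemma traversal_iff:
  "traversal (a, b) = cs \<longleftrightarrow> set cs = {c. path_cell (a, b) c} \<and> sorted_wrt (<) (map cell_rank cs)"
proof -
  let ?C = "{c. path_cell (a, b) c}"
  interpret folding_insort_key "(\<le>)" "(<)" ?C "position (a, b)"
  proof
    show "inj_on (position (a, b)) ?C"
    proof (rule inj_onI)
      fix c c' assume c: "c \<in> ?C" "c' \<in> ?C" and "position (a, b) c = position (a, b) c'"
      then have "\<not> cell_rank c < cell_rank c'" "\<not> cell_rank c' < cell_rank c"
        using position_less_iff[of c c'] position_less_iff[of c' c] by auto
      then show "c = c'" using c rank_inj[of c c'] by simp
    qed
  qed
  have "traversal (a, b) = cs \<longleftrightarrow>
      sorted_wrt (<) (map (position (a, b)) cs) \<and> set cs = ?C \<and> length cs = card ?C"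
    using sorted_key_list_of_set_unique[OF order_refl finite_path_cells, of cs]
    unfolding traversal_def cells_eq linorder_class.sorted_key_list_of_set_dict by blast
  also have "\<dots> \<longleftrightarrow> set cs = ?C \<and> sorted_wrt (<) (map cell_rank cs) \<and> length cs = card ?C"
  proof -
    have "sorted_wrt (<) (map (position (a, b)) cs) \<longleftrightarrow> sorted_wrt (<) (map cell_rank cs)"
      if C: "set cs = ?C"
    proof -
      have "position (a, b) (cs ! m) < position (a, b) (cs ! n) \<longleftrightarrow> cell_rank (cs ! m) < cell_rank (cs ! n)"
        if "m < n" "n < length cs" for m n
        using that C nth_mem[of m cs] nth_mem[of n cs] by (intro position_less_iff) auto
      then show ?thesis by (simp add: sorted_wrt_iff_nth_less)
    qed
    then show ?thesis by blast
  qed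
  also have "\<dots> \<longleftrightarrow> set cs = ?C \<and> sorted_wrt (<) (map cell_rank cs)"
  proof -
    have "length cs = card ?C" if C: "set cs = ?C" and sorted: "sorted_wrt (<) (map cell_rank cs)"
    proof -
      have "distinct (map cell_rank cs)" using sorted by (simp only: strict_sorted_iff)
      then have "distinct cs" by (simp only: distinct_map)
      then show ?thesis using distinct_card[of cs] C by (simp only:)
    qed
    then show ?thesis by blast
  qed
  finally show ?thesis .
qed

lemma set_traversal: "set (traversal (a, b)) = {c. path_cell (a, b) c}"
  and sorted_traversal: "sorted_wrt (<) (map cell_rank (traversal (a, b)))"
  using traversal_iff[of "traversal (a, b)"] by blast+


subsection \<open>Signs\<close>

lemma quadrilateral_LowerLeft:
  assumes "path_square (a, b) i j"
  shows "quadrilateral (region (Tri LowerLeft i j) \<inter> upper_half (a, b)) \<longleftrightarrow> 0 < height (a, b) i j"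
proof -
  let ?w = "(- real a, real b)"
  let ?A = "lattice_pt (i + 1) j" and ?B = "lattice_pt i j" and ?C = "lattice_pt i (j + 1)"
  have reg: "region (Tri LowerLeft i j) = convex hull {?A, ?B, ?C}"
    by (simp add: region.simps insert_commute)
  have A: "?w \<bullet> ?A < 0" and C: "0 < ?w \<bullet> ?C"
    using assms by (auto simp: inner_lattice_pt path_square_def)
  show ?thesis
  proof (cases "0 < height (a, b) i j")
    case True
    then have "0 < ?w \<bullet> ?B" by (simp add: inner_lattice_pt)
    \<comment> \<open>\<open>f\<close> and \<open>h\<close> form the dual basis to
      \<open>?B - ?A = (- 1, 0)\<close> and \<open>?C - ?A = (- 1, 1)\<close>.\<close>
    then have "quadrilateral (convex hull {?A, ?B, ?C} \<inter> {x. 0 \<le> ?w \<bullet> x})"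
      by (rule quadrilateral_slice[where f = "(- 1, - 1)" and h = "(0, 1)", OF A _ C])
        (simp_all add: lattice_pt_def)
    then show ?thesis using True by (simp add: reg upper_half_eq)
  next
    case False
    then have "?w \<bullet> ?B \<le> 0" by (simp add: inner_lattice_pt)
    then show ?thesis
      using not_quadrilateral_slice[OF less_imp_le[OF A] _ C] False by (simp add: reg upper_half_eq)
  qed
qed

lemma quadrilateral_UpperRight:
  assumes "path_square (a, b) i j"
  shows "quadrilateral (region (Tri UpperRight i j) \<inter> upper_half (a, b)) \<longleftrightarrow>
    0 < height (a, b) (i + 1) (j + 1)"
proof -
  let ?w = "(- real a, real b)"
  let ?A = "lattice_pt (i + 1) j" and ?B = "lattice_pt (i + 1) (j + 1)" and ?C = "lattice_pt i (j + 1)"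
  have reg: "region (Tri UpperRight i j) = convex hull {?A, ?B, ?C}"
    by (simp add: region.simps insert_commute)
  have A: "?w \<bullet> ?A < 0" and C: "0 < ?w \<bullet> ?C"
    using assms by (auto simp: inner_lattice_pt path_square_def)
  show ?thesis
  proof (cases "0 < height (a, b) (i + 1) (j + 1)")
    case True
    then have "0 < ?w \<bullet> ?B" by (simp add: inner_lattice_pt)
    then have "quadrilateral (convex hull {?A, ?B, ?C} \<inter> {x. 0 \<le> ?w \<bullet> x})"
      by (rule quadrilateral_slice[where f = "(1, 1)" and h = "(- 1, 0)", OF A _ C])
        (simp_all add: lattice_pt_def)
    then show ?thesis using True by (simp add: reg upper_half_eq)
  next
    case False
    then have "?w \<bullet> ?B \<le> 0" by (simp add: inner_lattice_pt)
    then show ?thesis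
      using not_quadrilateral_slice[OF less_imp_le[OF A] _ C] False by (simp add: reg upper_half_eq)
  qed
qed

text \<open>This triangle has rank 0, the least possible.\<close>

lemma traversal_Cons:
  obtains cs where "traversal (a, b) = Tri LowerLeft 0 0 # cs"
proof -
  have first: "Tri LowerLeft 0 0 \<in> set (traversal (a, b))"
    using path_square_0 by (simp add: set_traversal)
  then obtain c cs where cs: "traversal (a, b) = c # cs" by (cases "traversal (a, b)") auto
  have "path_cell (a, b) c" using set_traversal cs by auto
  then have "c = Tri LowerLeft 0 0"
    using first sorted_traversal rank_bounds(1)[of c] by (auto simp: cs)
  then show thesis using that cs by simp
qed

lemma traversal_snoc:
  obtains cs where "traversal (a, b) = cs @ [Tri UpperRight (int b - 1) (int a - 1)]"
proof -
  let ?l = "Tri UpperRight (int b - 1) (int a - 1)"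
  have "path_square (a, b) (int b - 1) (int a - 1)"
    using a_pos b_pos by (simp add: path_square_def height_eq algebra_simps)
  then have last: "?l \<in> set (traversal (a, b))" by (simp add: set_traversal)
  then have "traversal (a, b) \<noteq> []" by auto
  then obtain cs c where cs: "traversal (a, b) = cs @ [c]" by (metis append_butlast_last_id)
  have "path_cell (a, b) c" using set_traversal cs by auto
  then have "c = ?l"
    using last sorted_traversal rank_bounds(2)[of c] by (auto simp: cs sorted_wrt_append)
  then show thesis using that cs by simp
qed

lemma first_triangle: "first_triangle (a, b) = Tri LowerLeft 0 0"
  by (rule traversal_Cons) (simp add: first_triangle_def)

lemma tri_sign_LowerLeft:
  assumes "path_square (a, b) i j"
  shows "tri_sign (a, b) (Tri LowerLeft i j) =
    (if i = 0 \<and> j = 0 \<or> 0 < height (a, b) i j then SMinus else SPlus)"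
  using quadrilateral_LowerLeft[OF assms] by (simp add: tri_sign_def first_triangle)

lemma tri_sign_UpperRight:
  assumes "path_square (a, b) i j"
  shows "tri_sign (a, b) (Tri UpperRight i j) =
    (if 0 < height (a, b) (i + 1) (j + 1) then SMinus else SPlus)"
  using quadrilateral_UpperRight[OF assms] by (simp add: tri_sign_def first_triangle)

text \<open>\<open>a\<close> and \<open>b\<close> are not both even, so the midpoint of the segment
  is half-integral but not a lattice point. Such a point lies on an edge only as the midpoint of the
  edge.\<close>

lemma central_edge_iff:
  assumes "path_square (a, b) i j"
  shows "central_edge (a, b) (Edge d i j) \<longleftrightarrow> double_mid d i j = (int b, int a)"
proof -
  have odd: "odd a \<or> odd b" using coprime coprime_common_divisor[of a b 2] by auto
  have "central_edge (a, b) (Edge d i j) \<longleftrightarrow> (real b / 2, real a / 2) \<in> region (Edge d i j)"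
    by (simp add: central_edge_def seg_end_def midpoint_def)
  also have "\<dots> \<longleftrightarrow> double_mid d i j = (int b, int a)"
  proof (cases d)
    case Horizontal
    have "(real b / 2, real a / 2) \<in> region (Edge d i j) \<longleftrightarrow>
        int a = 2 * j \<and> 2 * i \<le> int b \<and> int b \<le> 2 * i + 2"
      using Horizontal by (auto simp: mem_region)
    then show ?thesis using Horizontal odd by auto presburger+
  next
    case Vertical
    have "(real b / 2, real a / 2) \<in> region (Edge d i j) \<longleftrightarrow>
        int b = 2 * i \<and> 2 * j \<le> int a \<and> int a \<le> 2 * j + 2"
      using Vertical by (auto simp: mem_region)
    then show ?thesis using Vertical odd by auto presburger+
  next
    case Diagonal
    have "(real b / 2, real a / 2) \<in> region (Edge d i j) \<longleftrightarrow>
        int a + int b = 2 * (i + j + 1) \<and> 2 * i \<le> int b \<and> int b \<le> 2 * i + 2"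
      using Diagonal by (auto simp: mem_region)
    then show ?thesis using Diagonal odd by auto presburger+
  qed
  finally show ?thesis .
qed

text \<open>A doubled midpoint on the line is an integer multiple of \<open>(b, a)\<close>; its
  coordinate sum is strictly between 0 and \<open>2 * (a + b)\<close>, which leaves the factor
  1.\<close>

lemma height_double_mid:
  assumes "path_square (a, b) i j"
  shows "case_prod (height (a, b)) (double_mid d i j) = 0 \<longleftrightarrow> double_mid d i j = (int b, int a)"
proof
  obtain x y where xy: "double_mid d i j = (x, y)" by fastforce
  assume "case_prod (height (a, b)) (double_mid d i j) = 0"
  then obtain m :: int where m: "x = m * b" "y = m * a" using xy height_eq_0[of x y] by auto
  have "0 < x + y" "x + y < 2 * (int a + int b)"
    using xy assms by (cases d; auto simp: path_square_def)+
  moreover have "x + y = m * (int a + int b)" using m by (simp add: algebra_simps)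
  ultimately have "0 < m" "m < 2"
    using a_pos mult_less_cancel_right_pos[of "int a + int b" m 2] by (auto simp: zero_less_mult_iff)
  then have "m = 1" by simp
  then show "double_mid d i j = (int b, int a)" using xy m by simp
qed (simp add: height_eq)

text \<open>Only the central edge has its midpoint on the line, so the change of its sign amounts to
  strict instead of weak positivity.\<close>

lemma G_edge_sign:
  assumes "path_square (a, b) i j"
  shows "(if central_edge (a, b) (Edge d i j) then SPlus else edge_sign (a, b) d i j) =
    (if 0 < case_prod (height (a, b)) (double_mid d i j) then SMinus else SPlus)"
  using height_double_mid[OF assms, of d]
  by (auto simp: central_edge_iff[OF assms] edge_sign_eq)

end


section \<open>Farey neighbours\<close>

text \<open>Prepares \<open>hj_expansion_glue\<close>. The first triangle is minus by convention;
  the last is plus because its upper right corner is the end point, of height 0.\<close>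

lemma (in segment) G_signs_shape:
  obtains cs where "traversal (a, b) = Tri LowerLeft 0 0 # cs"
    "concat (map (G_cell_signs k (a, b)) cs) \<noteq> []"
    "last (concat (map (G_cell_signs k (a, b)) cs)) = SPlus"
    "G_signs k (a, b) = SMinus # concat (map (G_cell_signs k (a, b)) cs)"
proof -
  obtain cs where cs: "traversal (a, b) = Tri LowerLeft 0 0 # cs" by (rule traversal_Cons)
  obtain ds where ds: "traversal (a, b) = ds @ [Tri UpperRight (int b - 1) (int a - 1)]"
    by (rule traversal_snoc)
  then obtain es where es: "cs = es @ [Tri UpperRight (int b - 1) (int a - 1)]"
    using cs by (cases ds) auto
  have "Tri UpperRight (int b - 1) (int a - 1) \<in> set (traversal (a, b))" using ds by simp
  then have "path_square (a, b) (int b - 1) (int a - 1)" by (simp add: set_traversal)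
  then have "tri_sign (a, b) (Tri UpperRight (int b - 1) (int a - 1)) = SPlus"
    by (simp add: tri_sign_UpperRight height_eq)
  then show thesis using that[OF cs] es tri_sign_LowerLeft[OF path_square_0]
    by (simp add: G_signs_def cs)
qed

text \<open>A common divisor divides both products in the determinant, hence their difference
  1.\<close>

lemma coprime_if_det_1:
  fixes p q p' q' :: nat
  assumes "q * p' = p * q' + 1"
  shows "coprime p q" "coprime p' q'"
proof -
  show "coprime p q"
  proof (rule coprimeI)
    fix d assume "d dvd p" "d dvd q"
    then have "d dvd p * q' + 1" "d dvd p * q'" using assms by (metis dvd_mult2)+
    then show "d dvd 1" using dvd_add_right_iff[of d "p * q'" 1] by blast
  qed
  show "coprime p' q'"
  proof (rule coprimeI)
    fix d assume "d dvd p'" "d dvd q'"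
    then have "d dvd p * q' + 1" "d dvd p * q'" using assms by (metis dvd_mult)+
    then show "d dvd 1" using dvd_add_right_iff[of d "p * q'" 1] by blast
  qed
qed

fun shift :: "int \<Rightarrow> int \<Rightarrow> cell \<Rightarrow> cell" where
  "shift x y (Tri h i j) = Tri h (x + i) (y + j)"
| "shift x y (Edge d i j) = Edge d (x + i) (y + j)"

text \<open>The antidiagonal of the square in the name of the cell. Unlike \<open>level\<close>, it
  is the same for all cells of a square; the cells of the mediant are split along it.\<close>

fun diag :: "cell \<Rightarrow> int" where
  "diag (Tri h i j) = i + j"
| "diag (Edge d i j) = i + j"

lemma rank_shift: "cell_rank (shift x y c) = 4 * (x + y) + cell_rank c"
  by (cases c rule: cell_rank.cases) auto

lemma shift_shift: "shift x y (shift (- x) (- y) c) = c"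
  by (cases c) auto

lemma diag_shift: "diag (shift x y c) = x + y + diag c"
  by (cases c) auto

lemma path_cell_diag:
  "path_cell t c \<Longrightarrow> 0 \<le> diag c \<and> diag c \<le> int (fst t) + int (snd t) - 2"
  by (cases c rule: cell_rank.cases) (auto simp: path_square_def)

section \<open>Heights for two neighbours and their mediant\<close>

locale farey_pair =
  fixes p q p' q' :: nat
  assumes p_pos: "0 < p" and q_pos: "0 < q" and p'_pos: "0 < p'" and q'_pos: "0 < q'"
    and det: "q * p' = p * q' + 1"
begin

sublocale r: segment p q
  using p_pos q_pos coprime_if_det_1[OF det] by unfold_locales

sublocale s: segment p' q'
  using p'_pos q'_pos coprime_if_det_1[OF det] by unfold_locales

sublocale t: segment "p + p'" "q + q'"
proof
  \<comment> \<open>The left neighbour and the mediant again have determinant 1.\<close>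
  have "q * (p + p') = p * (q + q') + 1" using det by (simp add: algebra_simps)
  then show "coprime (p + p') (q + q')" by (rule coprime_if_det_1(2))
qed (use p_pos q_pos in auto)

abbreviation "hr \<equiv> height (p, q)"
abbreviation "hs \<equiv> height (p', q')"
abbreviation "ht \<equiv> height (p + p', q + q')"
abbreviation "N \<equiv> int p + int q"
abbreviation "M \<equiv> int p' + int q'"

lemma det_int: "int q * int p' = int p * int q' + 1"
  using det by (metis of_nat_1 of_nat_add of_nat_mult)

lemma ht_eq: "ht x y = hr x y + hs x y"
  by (simp add: height_def algebra_simps)

text \<open>\<open>(q, p)\<close> itself has height \<open>- 1\<close>: it lies just below the line
  of the mediant.\<close>

lemma ht_shift: "ht (int q + x) (int p + y) = ht x y - 1"
  using det_int by (simp add: height_def algebra_simps)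

lemma ht_shift_2: "ht (2 * int q + x) (2 * int p + y) = ht x y - 2"
  using det_int by (simp add: height_def algebra_simps)

text \<open>
  \<open>(x, y)\<close> is \<open>- hs x y\<close> times \<open>(q, p)\<close> plus \<open>hr x y\<close> times \<open>(q', p')\<close>. This confines the
  lattice points of a bounded strip, where the three heights must then have the same sign.
\<close>

lemma sum_eq: "x + y = hr x y * M - hs x y * N"
proof -
  have "hr x y * M - hs x y * N = (x + y) * (int q * int p' - int p * int q')"
    by (simp add: height_def algebra_simps)
  then show ?thesis using det_int by simp
qed

lemma sum_bounds:
  shows "hr x y \<le> 0 \<Longrightarrow> 0 \<le> hs x y \<Longrightarrow> x + y \<le> 0"
    and "int m \<le> hr x y \<Longrightarrow> hs x y \<le> - int n \<Longrightarrow> int m * M + int n * N \<le> x + y"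
proof -
  assume *: "hr x y \<le> 0" "0 \<le> hs x y"
  have "hr x y * M \<le> 0" using * by (intro mult_nonpos_nonneg) auto
  moreover have "0 \<le> hs x y * N" using * by (intro mult_nonneg_nonneg) auto
  ultimately show "x + y \<le> 0" using sum_eq[of x y] by linarith
next
  assume *: "int m \<le> hr x y" "hs x y \<le> - int n"
  have "int m * M \<le> hr x y * M" using * by (intro mult_right_mono) auto
  moreover have "hs x y * N \<le> - int n * N" using * by (intro mult_right_mono) auto
  ultimately show "int m * M + int n * N \<le> x + y" using sum_eq[of x y] by linarith
qed

text \<open>The excluded sign combinations force \<open>x + y \<le> 0\<close> or
  \<open>M + N \<le> x + y\<close>. What remains is \<open>hr\<close> positive with
  \<open>hs\<close> nonnegative, or \<open>hr\<close> nonpositive with \<open>hs\<close> negative,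
  and \<open>ht\<close> is their sum.\<close>

lemma ht_pos_r:
  assumes "0 < x + y" "x + y \<le> N"
  shows "0 < ht x y \<longleftrightarrow> 0 < hr x y" "hr x y \<le> 0 \<Longrightarrow> ht x y < 0"
proof -
  have "\<not> (hr x y \<le> 0 \<and> 0 \<le> hs x y)" using assms sum_bounds(1)[of x y] by auto
  moreover have "\<not> (1 \<le> hr x y \<and> hs x y \<le> - 1)"
    using assms sum_bounds(2)[of 1 x y 1] p'_pos by auto
  ultimately show "0 < ht x y \<longleftrightarrow> 0 < hr x y" "hr x y \<le> 0 \<Longrightarrow> ht x y < 0"
    using ht_eq[of x y] by auto
qed

lemma ht_neg_r:
  assumes "0 < x + y" "x + y < N"
  shows "ht x y < 0 \<longleftrightarrow> hr x y < 0"
  using ht_pos_r[of x y] r.height_neq_0_sum[of x y] assms by auto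

text \<open>Meant for doubled midpoints, hence the wider strip. There \<open>1 \<le> hr\<close>
  yields only \<open>- 1 \<le> hs\<close>, so \<open>ht\<close> may vanish: the weak inequality of
  \<open>F\<close> matches the strict one of \<open>G\<close>.\<close>

lemma ht_nonneg_r:
  assumes "0 < x + y" "x + y < 2 * N"
  shows "0 \<le> ht x y \<longleftrightarrow> 0 < hr x y"
proof -
  have "\<not> (hr x y \<le> 0 \<and> 0 \<le> hs x y)" using assms sum_bounds(1)[of x y] by auto
  moreover have "\<not> (1 \<le> hr x y \<and> hs x y \<le> - 2)"
    using assms sum_bounds(2)[of 1 x y 2] by auto
  ultimately show ?thesis using ht_eq[of x y] by auto
qed

text \<open>The shifted height is \<open>hr + hs - 1\<close>. A positive \<open>hs\<close> forces
  \<open>1 \<le> hr\<close>, a zero \<open>hs\<close> forces \<open>hr = 1\<close>, and a negative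
  \<open>hs\<close> forces \<open>hr \<le> 0\<close>.\<close>

lemma ht_pos_s:
  assumes "0 < x + y" "x + y \<le> M"
  shows "0 < ht (int q + x) (int p + y) \<longleftrightarrow> 0 < hs x y"
    and "hs x y < 0 \<Longrightarrow> ht (int q + x) (int p + y) < 0"
proof -
  have "\<not> (hr x y \<le> 0 \<and> 0 \<le> hs x y)" using assms sum_bounds(1)[of x y] by auto
  moreover have "\<not> (1 \<le> hr x y \<and> hs x y \<le> - 1)"
    using assms sum_bounds(2)[of 1 x y 1] p_pos by auto
  moreover have "\<not> (2 \<le> hr x y \<and> hs x y \<le> 0)"
    using assms sum_bounds(2)[of 2 x y 0] p'_pos by auto
  ultimately show "0 < ht (int q + x) (int p + y) \<longleftrightarrow> 0 < hs x y"
    "hs x y < 0 \<Longrightarrow> ht (int q + x) (int p + y) < 0"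
    using ht_eq[of x y] ht_shift[of x y] by auto
qed

lemma ht_neg_s:
  assumes "0 < x + y" "x + y < M"
  shows "ht (int q + x) (int p + y) < 0 \<longleftrightarrow> hs x y < 0"
proof -
  have "hs x y \<noteq> 0" using s.height_neq_0_sum[of x y] assms by simp
  then show ?thesis using ht_pos_s[of x y] assms by auto
qed

text \<open>For doubled points the shift costs 2. A positive \<open>hs\<close> forces
  \<open>1 \<le> hr\<close>, and otherwise \<open>hr \<le> 1\<close>.\<close>

lemma ht_nonneg_s:
  assumes "0 < x + y" "x + y < 2 * M"
  shows "0 \<le> ht (2 * int q + x) (2 * int p + y) \<longleftrightarrow> 0 < hs x y"
proof -
  have "\<not> (hr x y \<le> 0 \<and> 0 \<le> hs x y)" using assms sum_bounds(1)[of x y] by auto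
  moreover have "\<not> (2 \<le> hr x y \<and> hs x y \<le> 0)"
    using assms sum_bounds(2)[of 2 x y 0] by auto
  ultimately show ?thesis using ht_eq[of x y] ht_shift_2[of x y] by auto
qed

section \<open>Cells of the mediant\<close>

lemma path_square_r:
  assumes "i + j \<le> N - 2"
  shows "path_square (p + p', q + q') i j \<longleftrightarrow> path_square (p, q) i j"
  using assms p'_pos q'_pos ht_pos_r(1)[of i "j + 1"] ht_neg_r[of "i + 1" j]
  by (auto simp: path_square_def)

lemma path_square_s:
  assumes "0 \<le> i + j"
  shows "path_square (p + p', q + q') (int q + i) (int p + j) \<longleftrightarrow> path_square (p', q') i j"
  using assms ht_pos_s(1)[of i "j + 1"] ht_neg_s[of "i + 1" j]
  by (auto simp: path_square_def add.assoc)

lemma path_square_mid: "path_square (p + p', q + q') (int q - 1) (int p)"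
  using ht_shift[of "- 1" 1] ht_shift[of 0 0] p_pos q_pos p'_pos q'_pos
  by (simp add: path_square_def height_def algebra_simps)

lemma path_cell_r:
  assumes "diag c \<le> N - 2"
  shows "path_cell (p + p', q + q') c \<longleftrightarrow> path_cell (p, q) c"
proof -
  have corner: "(0 < ht i j \<longleftrightarrow> 0 < hr i j) \<and> (ht i j < 0 \<longleftrightarrow> hr i j < 0)"
    if "path_square (p, q) i j" for i j
  proof (cases "i + j = 0")
    case True
    then have "i = 0" "j = 0" using r.path_square_bounds[OF that] by auto
    then show ?thesis by (simp add: height_def)
  next
    case False
    then have "0 < i + j" "i + j < N" using that by (auto simp: path_square_def)
    then show ?thesis using ht_pos_r(1)[of i j] ht_neg_r[of i j] by auto
  qed
  show ?thesis
    using assms corner path_square_r by (cases c rule: r.entry_x.cases) auto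
qed

text \<open>The origin moves to \<open>(q, p)\<close>, which is below the line of the mediant. So
  the first translated square is entered through its left edge, which is an additional cell.\<close>

lemma path_cell_s:
  assumes "0 \<le> diag c"
  shows "path_cell (p + p', q + q') (shift q p c) \<longleftrightarrow> path_cell (p', q') c \<or> c = Edge Vertical 0 0"
proof -
  have corner: "(0 < ht (int q + i) (int p + j) \<longleftrightarrow> 0 < hs i j) \<and>
      (ht (int q + i) (int p + j) < 0 \<longleftrightarrow> hs i j < 0 \<or> i = 0 \<and> j = 0)"
    if "path_square (p', q') i j" for i j
  proof (cases "i + j = 0")
    case True
    then have "i = 0" "j = 0" using s.path_square_bounds[OF that] by auto
    then show ?thesis using ht_shift[of 0 0] by (simp add: height_def)
  next
    case False
    then have "0 < i + j" "i + j < M" using that by (auto simp: path_square_def)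
    then show ?thesis using ht_pos_s(1)[of i j] ht_neg_s[of i j] by auto
  qed
  show ?thesis
    using assms corner path_square_s s.path_square_0 by (cases c rule: r.entry_x.cases) auto
qed

text \<open>The last edge is the left side of the first translated square and has antidiagonal
  \<open>N\<close>; the other four cells have \<open>N - 1\<close>, hence \<open>butlast\<close>
  below.\<close>

definition mid_cells :: "cell list" where
  "mid_cells = [Edge Horizontal (int q - 1) p, Tri LowerLeft (int q - 1) p,
     Edge Diagonal (int q - 1) p, Tri UpperRight (int q - 1) p, Edge Vertical q p]"

lemma ht_mid: "0 < ht (int q - 1) p"
  using ht_shift[of "- 1" 0] p_pos p'_pos by (simp add: height_def)

text \<open>There is one path square on this antidiagonal, and its lower left corner is above the
  line, so it is entered from below.\<close>

lemma path_cell_mid: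
  assumes "diag c = N - 1"
  shows "path_cell (p + p', q + q') c \<longleftrightarrow> c \<in> set (butlast mid_cells)"
proof -
  have sq: "path_square (p + p', q + q') i j \<longleftrightarrow> i = int q - 1 \<and> j = int p"
    if "i + j = N - 1" for i j
    using t.path_square_unique[OF _ path_square_mid, of i j] path_square_mid that by auto
  show ?thesis
  proof (cases c)
    case (Tri h i j)
    then show ?thesis using sq[of i j] assms by (cases h) (auto simp: mid_cells_def)
  next
    case (Edge d i j)
    then have "path_square (p + p', q + q') i j \<longleftrightarrow> i = int q - 1 \<and> j = int p"
      using sq assms by simp
    then show ?thesis using Edge ht_mid by (cases d) (auto simp: mid_cells_def)
  qed
qed

text \<open>By \<open>traversal_iff\<close>, sets and ranks suffice. The sets are compared by
  antidiagonal: up to \<open>N - 2\<close>, equal to \<open>N - 1\<close>, from \<open>N\<close> on.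
  The ranks run up to \<open>4 * N - 6\<close>, from \<open>4 * N - 5\<close> to
  \<open>4 * N - 1\<close>, and from \<open>4 * N\<close> on.\<close>

lemma traversal_eq:
  "traversal (p + p', q + q') = traversal (p, q) @ mid_cells @ map (shift q p) (traversal (p', q'))"
proof -
  let ?cs = "traversal (p, q) @ mid_cells @ map (shift q p) (traversal (p', q'))"
  have "path_cell (p + p', q + q') c \<longleftrightarrow> path_cell (p, q) c \<or> c \<in> set mid_cells \<or>
      c \<in> shift q p ` {c. path_cell (p', q') c}" for c
  proof -
    define c' where "c' = shift (- int q) (- int p) c"
    have c: "c = shift q p c'" using shift_shift by (simp add: c'_def)
    have img: "c \<in> shift q p ` {c. path_cell (p', q') c} \<longleftrightarrow> path_cell (p', q') c'"
    proof -
      have "inj (shift q p)"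
      proof (rule injI)
        fix c d assume "shift (int q) (int p) c = shift (int q) (int p) d"
        then show "c = d" by (cases c; cases d) auto
      qed
      then show ?thesis using c inj_image_mem_iff[of "shift q p" c'] by simp
    qed
    have dc: "diag c = N + diag c'" using c diag_shift by (simp add: add.commute)
    have mid: "c \<in> set mid_cells \<longleftrightarrow> c \<in> set (butlast mid_cells) \<or> c' = Edge Vertical 0 0"
      unfolding c by (cases c') (auto simp: mid_cells_def)
    have mid_diag: "diag c = N - 1" if "c \<in> set (butlast mid_cells)"
      using that by (auto simp: mid_cells_def)
    have vert: "diag c = N" if "c' = Edge Vertical 0 0" using that dc by simp
    have r: "diag c \<le> N - 2" if "path_cell (p, q) c" using path_cell_diag[OF that] by simp
    have s: "N \<le> diag c" if "path_cell (p', q') c'" using path_cell_diag[OF that] dc by simp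
    consider "diag c \<le> N - 2" | "diag c = N - 1" | "N \<le> diag c" by linarith
    then show ?thesis
    proof cases
      case 1
      then have "c \<notin> set mid_cells" "\<not> path_cell (p', q') c'"
        using mid mid_diag vert s by auto
      then show ?thesis unfolding img path_cell_r[OF 1] by blast
    next
      case 2
      then have "c' \<noteq> Edge Vertical 0 0" "\<not> path_cell (p', q') c'" "\<not> path_cell (p, q) c"
        using vert s r by auto
      then show ?thesis unfolding img path_cell_mid[OF 2] mid by blast
    next
      case 3
      then have "c \<notin> set (butlast mid_cells)" "\<not> path_cell (p, q) c"
        using mid_diag r by auto
      moreover have "path_cell (p + p', q + q') c \<longleftrightarrow> path_cell (p', q') c' \<or> c' = Edge Vertical 0 0"
        unfolding c using 3 dc by (intro path_cell_s) simp
      ultimately show ?thesis unfolding img mid by blast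
    qed
  qed
  then have "set ?cs = {c. path_cell (p + p', q + q') c}"
    by (auto simp: r.set_traversal s.set_traversal)
  moreover have "sorted_wrt (<) (map cell_rank ?cs)"
  proof -
    have mid: "map cell_rank mid_cells = [4 * N - 5, 4 * N - 4, 4 * N - 3, 4 * N - 2, 4 * N - 1]"
      by (simp add: mid_cells_def)
    have r: "cell_rank c \<le> 4 * N - 6" if "c \<in> set (traversal (p, q))" for c
      using that r.rank_bounds by (simp add: r.set_traversal)
    have s: "4 * N \<le> cell_rank (shift q p c)" if "c \<in> set (traversal (p', q'))" for c
      using that s.rank_bounds by (simp add: s.set_traversal rank_shift)
    have "sorted_wrt (<) (map cell_rank (map (shift q p) (traversal (p', q'))))"
      using s.sorted_traversal by (simp add: sorted_wrt_map rank_shift)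
    then show ?thesis
      using r.sorted_traversal mid
      by (auto simp: sorted_wrt_append dest!: r s)
  qed
  ultimately show ?thesis using t.traversal_iff by blast
qed

section \<open>Signs of the mediant\<close>

lemma F_cell_signs_r:
  assumes "path_cell (p, q) c"
  shows "F_cell_signs k (p + p', q + q') c = G_cell_signs k (p, q) c"
proof (cases c)
  case (Tri h i j)
  then have sq: "path_square (p, q) i j" using assms by simp
  then have ij: "0 \<le> i + j" "i + j \<le> N - 2" by (auto simp: path_square_def)
  have sq_t: "path_square (p + p', q + q') i j" using path_square_r sq ij by simp
  show ?thesis
  proof (cases h)
    case LowerLeft
    have "i = 0 \<and> j = 0 \<or> 0 < i + j" using r.path_square_bounds[OF sq] by auto
    then show ?thesis
      using Tri LowerLeft ij ht_pos_r(1)[of i j]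
      by (auto simp: t.tri_sign_LowerLeft[OF sq_t] r.tri_sign_LowerLeft[OF sq])
  next
    case UpperRight
    \<comment> \<open>For the last triangle the corner is \<open>(q, p)\<close>, of height 0 for
      \<open>r\<close> and \<open>- 1\<close> for \<open>t\<close>; both give plus.\<close>
    then show ?thesis
      using Tri ij ht_pos_r(1)[of "i + 1" "j + 1"]
      by (simp add: t.tri_sign_UpperRight[OF sq_t] r.tri_sign_UpperRight[OF sq])
  qed
next
  case (Edge d i j)
  then have sq: "path_square (p, q) i j" using assms by (cases d) auto
  obtain x y where xy: "double_mid d i j = (x, y)" by fastforce
  have "0 < x + y" "x + y < 2 * N" using sq xy by (cases d; auto simp: path_square_def)+
  then show ?thesis
    using Edge xy ht_nonneg_r[of x y] by (simp add: r.G_edge_sign[OF sq] edge_sign_eq)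
qed

lemma F_cell_signs_s:
  assumes "path_cell (p', q') c" "c \<noteq> Tri LowerLeft 0 0"
  shows "F_cell_signs k (p + p', q + q') (shift q p c) = G_cell_signs k (p', q') c"
proof (cases c)
  case (Tri h i j)
  then have sq: "path_square (p', q') i j" using assms by simp
  then have ij: "0 \<le> i + j" "i + j \<le> M - 2" by (auto simp: path_square_def)
  have sq_t: "path_square (p + p', q + q') (int q + i) (int p + j)" using path_square_s sq ij by simp
  note bnd = s.path_square_bounds[OF sq]
  show ?thesis
  proof (cases h)
    case LowerLeft
    then have "0 < i + j" using Tri assms(2) bnd by auto
    then show ?thesis
      using Tri LowerLeft ij ht_pos_s(1)[of i j] bnd q_pos
      by (auto simp: t.tri_sign_LowerLeft[OF sq_t] s.tri_sign_LowerLeft[OF sq])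
  next
    case UpperRight
    then show ?thesis
      using Tri ij ht_pos_s(1)[of "i + 1" "j + 1"]
      by (simp add: t.tri_sign_UpperRight[OF sq_t] s.tri_sign_UpperRight[OF sq] add.assoc)
  qed
next
  case (Edge d i j)
  then have sq: "path_square (p', q') i j" using assms by (cases d) auto
  obtain x y where xy: "double_mid d i j = (x, y)" by fastforce
  have "0 < x + y" "x + y < 2 * M" using sq xy by (cases d; auto simp: path_square_def)+
  moreover have "double_mid d (int q + i) (int p + j) = (2 * int q + x, 2 * int p + y)"
    using xy by (cases d) auto
  ultimately show ?thesis
    using Edge xy ht_nonneg_s[of x y] by (simp add: s.G_edge_sign[OF sq] edge_sign_eq)
qed

text \<open>Its lower left corner \<open>(q, p)\<close> is below the line, and it is no longer the
  first triangle.\<close>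

lemma F_cell_signs_s_first:
  "F_cell_signs k (p + p', q + q') (shift q p (Tri LowerLeft 0 0)) = [SPlus]"
proof -
  have "path_square (p + p', q + q') (int q) (int p)"
    using path_square_s[of 0 0] s.path_square_0 by simp
  then show ?thesis using ht_shift[of 0 0] q_pos by (simp add: t.tri_sign_LowerLeft height_def)
qed

text \<open>Three edges give \<open>k\<close> signs each and two triangles give one each. With the
  plus sign that follows, they produce the entry \<open>3 * k + 4\<close>.\<close>

lemma F_cell_signs_mid:
  "concat (map (F_cell_signs k (p + p', q + q')) mid_cells) = replicate (3 * k + 2) SMinus"
proof -
  have pos: "2 \<le> int p + int p'" "2 \<le> int q + int q'" using p_pos p'_pos q_pos q'_pos by linarith+
  \<comment> \<open>Relative to \<open>(2 * q, 2 * p)\<close>, the doubled midpoints of the three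
    edges are \<open>(- 1, 0)\<close>, \<open>(- 1, 1)\<close> and \<open>(0, 1)\<close>.\<close>
  have ht: "ht (2 * int q + x) (2 * int p + y) = (int q + int q') * y - (int p + int p') * x - 2" for x y
    using ht_shift_2[of x y] by (simp add: height_def)
  have "edge_sign (p + p', q + q') Horizontal (int q - 1) p = SMinus"
    using ht[of "- 1" 0] pos by (simp add: edge_sign_eq algebra_simps)
  moreover have "edge_sign (p + p', q + q') Diagonal (int q - 1) p = SMinus"
    using ht[of "- 1" 1] pos by (simp add: edge_sign_eq algebra_simps)
  moreover have "edge_sign (p + p', q + q') Vertical q p = SMinus"
    using ht[of 0 1] pos by (simp add: edge_sign_eq algebra_simps)
  moreover have "tri_sign (p + p', q + q') (Tri LowerLeft (int q - 1) p) = SMinus"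
    using t.tri_sign_LowerLeft[OF path_square_mid] ht_mid by simp
  moreover have "tri_sign (p + p', q + q') (Tri UpperRight (int q - 1) p) = SMinus"
    using t.tri_sign_UpperRight[OF path_square_mid] ht_shift[of 0 1] pos by (simp add: height_def)
  moreover have "replicate (3 * k + 2) SMinus =
      replicate k SMinus @ SMinus # replicate k SMinus @ SMinus # replicate k SMinus"
  proof -
    have "3 * k + 2 = k + Suc (k + Suc k)" by simp
    then show ?thesis by (simp only: replicate_add replicate_Suc append_Cons)
  qed
  ultimately show ?thesis by (simp add: mid_cells_def)
qed

section \<open>Concatenation of the expansions\<close>

theorem F_minus_eq: "F_minus k (p + p', q + q') = G_minus k (p, q) @ [3 * int k + 4] @ G_minus k (p', q')"
proof -
  let ?F = "F_cell_signs k (p + p', q + q')"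
  obtain cr where cr: "traversal (p, q) = Tri LowerLeft 0 0 # cr"
      "concat (map (G_cell_signs k (p, q)) cr) \<noteq> []"
      "last (concat (map (G_cell_signs k (p, q)) cr)) = SPlus"
      "G_signs k (p, q) = SMinus # concat (map (G_cell_signs k (p, q)) cr)"
    by (rule r.G_signs_shape)
  obtain cs where cs: "traversal (p', q') = Tri LowerLeft 0 0 # cs"
      "concat (map (G_cell_signs k (p', q')) cs) \<noteq> []"
      "last (concat (map (G_cell_signs k (p', q')) cs)) = SPlus"
      "G_signs k (p', q') = SMinus # concat (map (G_cell_signs k (p', q')) cs)"
    by (rule s.G_signs_shape)
  have "map ?F (traversal (p, q)) = map (G_cell_signs k (p, q)) (traversal (p, q))"
    using F_cell_signs_r by (simp add: r.set_traversal)
  moreover have "map (?F \<circ> shift q p) cs = map (G_cell_signs k (p', q')) cs"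
  proof -
    have "c \<noteq> Tri LowerLeft 0 0" if "c \<in> set cs" for c
      using s.sorted_traversal that by (auto simp: cs(1))
    moreover have "path_cell (p', q') c" if "c \<in> set cs" for c
      using s.set_traversal that by (auto simp: cs(1))
    ultimately show ?thesis using F_cell_signs_s by simp
  qed
  moreover have "F_signs k (p + p', q + q') = concat (map ?F (traversal (p, q))) @
      concat (map ?F mid_cells) @ ?F (shift q p (Tri LowerLeft 0 0)) @ concat (map (?F \<circ> shift q p) cs)"
    unfolding F_signs_def traversal_eq cs(1)
    by (simp only: map_append concat_append list.map concat.simps map_map)
  ultimately have "F_signs k (p + p', q + q') =
      G_signs k (p, q) @ replicate (3 * k + 2) SMinus @ [SPlus] @
      concat (map (G_cell_signs k (p', q')) cs)"
    by (simp only: F_cell_signs_mid F_cell_signs_s_first G_signs_def)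
  then show ?thesis
    using hj_expansion_glue[OF cr(2,3) cs(2,3), of "3 * k + 2"]
    by (simp add: F_minus_def G_minus_def F_plus_def G_plus_def cr(4) cs(4) del: block_lengths.simps)
qed

end

text \<open>Replacing a neighbour by the mediant adds one column of the determinant to the
  other.\<close>

lemma farey_vertex_det:
  assumes "farey_vertex r t s"
  shows "snd r * fst s = fst r * snd s + 1 \<and> t = (fst r + fst s, snd r + snd s)"
  using assms by induction (auto simp: algebra_simps)

theorem theorem8p16:
  fixes k :: nat and r t s :: fraction
  assumes "farey_vertex r t s"
    and "0 < frac_val t" and "frac_val t < 1"
    and "r \<noteq> (0, 1)" and "s \<noteq> (1, 1)"
  shows "F_minus k t = G_minus k r @ [3 * int k + 4] @ G_minus k s"
proof -
  obtain p q p' q' where rs: "r = (p, q)" "s = (p', q')" by fastforce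
  have det: "q * p' = p * q' + 1" and t: "t = (p + p', q + q')"
    using farey_vertex_det[OF assms(1)] rs by auto
  have pos: "0 < q" "0 < p'" using det by (cases q; cases p'; simp)+
  have "0 < p"
  proof (rule ccontr)
    assume "\<not> 0 < p"
    \<comment> \<open>\<open>p = 0\<close> leaves \<open>q * p' = 1\<close>, so \<open>r\<close>
      would be \<open>(0, 1)\<close>.\<close>
    then show False using det assms(4) rs by simp
  qed
  moreover have "0 < q'"
  proof (rule ccontr)
    assume "\<not> 0 < q'"
    \<comment> \<open>Here \<open>s\<close> has denominator 0, and \<open>t\<close> would be the
      integer \<open>p + 1\<close>, against \<open>t < 1\<close>.\<close>
    then have "q = 1" "p' = 1" "q' = 0" using det by auto
    then show False using assms(3) t by (simp add: frac_val_def)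
  qed
  ultimately interpret farey_pair p q p' q' using pos det by unfold_locales
  show ?thesis unfolding rs t by (rule F_minus_eq)
qed

end
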